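(* Let $\alpha\in(0,1)$, $T>0$, $\mathcal{A}\in\mathbb{C}^{d\times d}$, $\vartheta\in\mathcal{C}[0,T]$ and $x_0\in\mathbb{C}^d$. Then the function $$x(t)=\mathcal{E}_\alpha(\mathcal{A}t)x_0+\sum_{j=0}^\infty\mathcal{A}^j\,{}^LJ^{(j+1)\circ\alpha}\vartheta(t)$$ is well defined, belongs to $\mathcal{C}[0,T]$, and satisfies for every $t\in[0,T]$ the integral equation $$x(t)=x_0+\frac{1}{\Gamma(\alpha)\Gamma(2-\alpha)}\int_0^t (t-s)^{\alpha-1}s^{1-\alpha}\big(\mathcal{A}x(s)+\vartheta(s)\big)\,ds .$$ If $x$ and $\vartheta$ are absolutely continuous on $[0,T]$, then $x$ satisfies ${}^LD^\alpha x(t)=\mathcal{A}x(t)+\vartheta(t)$ for almost every $t\in[0,T]$, with $x(0)=x_0$. If $x$ and $\vartheta$ are given by power series absolutely convergent on $[0,T]$, then this equation holds for every $t\in[0,T]$.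
   Context: Mittag–Leffler-type function: $\mathcal{E}_\alpha(s)=\sum_{n=0}^\infty\frac{s^n}{\Gamma(2-\alpha)^n\prod_{j=1}^n\frac{\Gamma(j+1)}{\Gamma(j+1-\alpha)}}$, also for square matrix arguments. $\mathcal{C}[0,T]$: continuous functions $[0,T]\to\mathbb{C}^d$. L-fractional integral ${}^LJ^\alpha y(t)=\frac{1}{\Gamma(\alpha)\Gamma(2-\alpha)}\int_0^t (t-s)^{\alpha-1}s^{1-\alpha}y(s)\,ds$, with $m$-fold composition ${}^LJ^{m\circ\alpha}$. Caputo derivative ${}^CD^\alpha x(t)=\frac{1}{\Gamma(1-\alpha)}\int_0^t (t-\tau)^{-\alpha}x'(\tau)d\tau$ for absolutely continuous $x$ ($x'\in L^1$, $x(t)=x(0)+\int_0^tx'$); L-fractional derivative ${}^LD^\alpha x(t)=\frac{\Gamma(2-\alpha)}{t^{1-\alpha}}{}^CD^\alpha x(t)$, extended at $t=0$ by continuity (value $x'(0)$) for $C^2$ functions. *)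

theory Defs
  imports "HOL-Analysis.Analysis"
begin

definition mat_pow :: "complex^'d^'d \<Rightarrow> nat \<Rightarrow> complex^'d^'d" where
  "mat_pow A n = ((\<lambda>B. A ** B) ^^ n) (mat 1)"

definition mlf_coeff :: "real \<Rightarrow> nat \<Rightarrow> real" where
  "mlf_coeff \<alpha> n = Gamma (2 - \<alpha>) ^ n * (\<Prod>j=1..n. Gamma (real j + 1) / Gamma (real j + 1 - \<alpha>))"

definition mlf_term :: "real \<Rightarrow> complex^'d^'d \<Rightarrow> nat \<Rightarrow> complex^'d^'d" where
  "mlf_term \<alpha> M n = (1 / mlf_coeff \<alpha> n) *\<^sub>R mat_pow M n"

definition mlf_mat :: "real \<Rightarrow> complex^'d^'d \<Rightarrow> complex^'d^'d" where
  "mlf_mat \<alpha> M = (\<Sum>n. mlf_term \<alpha> M n)"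

definition LJ :: "real \<Rightarrow> (real \<Rightarrow> 'a::real_normed_vector) \<Rightarrow> real \<Rightarrow> 'a" where
  "LJ \<alpha> y t = (1 / (Gamma \<alpha> * Gamma (2 - \<alpha>))) *\<^sub>R
      integral {0..t} (\<lambda>s. ((t - s) powr (\<alpha> - 1) * s powr (1 - \<alpha>)) *\<^sub>R y s)"

definition LJ_iter :: "nat \<Rightarrow> real \<Rightarrow> (real \<Rightarrow> 'a::real_normed_vector) \<Rightarrow> real \<Rightarrow> 'a" where
  "LJ_iter m \<alpha> y = (LJ \<alpha> ^^ m) y"

definition abs_cont_on :: "real \<Rightarrow> (real \<Rightarrow> 'a::euclidean_space) \<Rightarrow> bool" where
  "abs_cont_on T f \<longleftrightarrow> (\<exists>g. g absolutely_integrable_on {0..T} \<and>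
      (\<forall>t\<in>{0..T}. f t = f 0 + integral {0..t} g))"

definition caputo :: "real \<Rightarrow> real \<Rightarrow> (real \<Rightarrow> 'a::real_normed_vector) \<Rightarrow> real \<Rightarrow> 'a" where
  "caputo T \<alpha> x t = (1 / Gamma (1 - \<alpha>)) *\<^sub>R
      integral {0..t} (\<lambda>\<tau>. (t - \<tau>) powr (- \<alpha>) *\<^sub>R vector_derivative x (at \<tau> within {0..T}))"

text \<open>L-fractional derivative; at t = 0 it is extended by continuity, with value x'(0).\<close>
definition LD :: "real \<Rightarrow> real \<Rightarrow> (real \<Rightarrow> 'a::real_normed_vector) \<Rightarrow> real \<Rightarrow> 'a" where
  "LD T \<alpha> x t = (if t = 0 then vector_derivative x (at 0 within {0..T})
      else (Gamma (2 - \<alpha>) / t powr (1 - \<alpha>)) *\<^sub>R caputo T \<alpha> x t)"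

definition power_series_on :: "real \<Rightarrow> (real \<Rightarrow> 'a::real_normed_vector) \<Rightarrow> bool" where
  "power_series_on T f \<longleftrightarrow> (\<exists>c::nat \<Rightarrow> 'a. summable (\<lambda>n. norm (c n) * T ^ n) \<and>
      (\<forall>t\<in>{0..T}. f t = (\<Sum>n. (t ^ n) *\<^sub>R c n)))"

end

theory Submission
  imports Defs
begin

text \<open>
  Since \<open>LJ\<close> maps \<open>s ^ n / c\<^sub>n\<close> to \<open>t ^ (n + 1) / c\<^sub>n\<^sub>+\<^sub>1\<close> (with \<open>c\<^sub>n\<close> = \<open>mlf_coeff \<alpha> n\<close>), it sends
  \<open>A *v Y\<^sub>n\<close> to \<open>Y\<^sub>n\<^sub>+\<^sub>1\<close>, where \<open>Y\<^sub>n(t) = A\<^sup>n (t ^ n / c\<^sub>n *\<^sub>R x0 + LJ_iter (n + 1) \<alpha> \<theta> t)\<close>. The ratios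
  \<open>c\<^sub>n / c\<^sub>n\<^sub>+\<^sub>1\<close> tend to 0 by log-convexity of \<open>Gamma\<close>, so \<open>x = \<Sum> Y\<^sub>n\<close> converges uniformly on
  \<open>[0, T]\<close> and telescopes under \<open>LJ\<close> to the integral equation.

  For the almost-everywhere equation let \<open>J\<^sup>p\<close> be the Riemann-Liouville integral and \<open>g\<close> the density
  of \<open>x\<close>. The equation reads \<open>J\<^sup>1 g = J\<^sup>\<alpha> h\<close>; applying \<open>J\<^sup>1\<^sup>-\<^sup>\<alpha>\<close> and the semigroup law gives
  \<open>J\<^sup>1 (J\<^sup>1\<^sup>-\<^sup>\<alpha> g) = J\<^sup>1 h\<close>, hence \<open>J\<^sup>1\<^sup>-\<^sup>\<alpha> g = h\<close> almost everywhere by Lebesgue's differentiation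
  theorem, which also identifies \<open>g\<close> with the derivative of \<open>x\<close>.

  If \<open>A *v x + \<theta> = \<Sum> t ^ n *\<^sub>R d\<^sub>n\<close>, the integral equation gives
  \<open>x = x0 + \<Sum> (c\<^sub>n / c\<^sub>n\<^sub>+\<^sub>1) t ^ (n + 1) *\<^sub>R d\<^sub>n\<close>. The Caputo derivative of this series can be taken
  termwise even at \<open>t = T\<close>, where \<open>x'\<close> may be unbounded, because the integrals of the norms of the
  terms are again a multiple of \<open>norm d\<^sub>n * t ^ n\<close>.
\<close>

section \<open>Differentiation of indefinite integrals\<close>

text \<open>Where the derivative fails, arbitrarily short intervals from \<open>x\<close> to \<open>y\<close> violate the Henstock
  estimate by a fixed proportion; a disjoint Vitali subfamily then has small total length.\<close>
lemma negligible_not_differentiable_indefinite_integral: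
  fixes f :: "real \<Rightarrow> 'a::euclidean_space"
  assumes f: "f integrable_on {a..b}"
  shows "negligible {x \<in> {a..b}. \<not> ((\<lambda>t. integral {a..t} f) has_vector_derivative f x) (at x within {a..b})}"
proof -
  define F where "F = (\<lambda>t. integral {a..t} f)"
  define Q where "Q \<eta> x y \<longleftrightarrow> y \<in> {a..b} \<and> y \<noteq> x \<and> norm (F y - F x - (y - x) *\<^sub>R f x) > \<eta> * \<bar>y - x\<bar>" for \<eta> x y
  \<comment> \<open>Non-differentiability at \<open>x\<close> puts \<open>x\<close> into
    \<open>E \<eta>\<close> for some positive \<open>\<eta>\<close>; running through the values
    \<open>1 / Suc n\<close> covers the exceptional set by countably many such sets.\<close>
  define E where "E \<eta> = {x \<in> {a..b}. \<forall>d>0. \<exists>y. \<bar>y - x\<bar> < d \<and> Q \<eta> x y}" for \<eta>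
  have int_diff: "integral {x..y} f = F y - F x" if "x \<in> {a..b}" "y \<in> {a..b}" "x \<le> y" for x y
  proof -
    have "f integrable_on {a..y}"
      using f that by (auto intro: integrable_subinterval_real)
    from Henstock_Kurzweil_Integration.integral_combine[OF _ that(3) this] that show ?thesis
      by (auto simp: F_def algebra_simps)
  qed
  have neg: "negligible (E \<eta>)" if \<eta>: "\<eta> > 0" for \<eta>
    unfolding negligible_outer_le
  proof (intro allI impI)
    fix e :: real assume "e > 0"
    \<comment> \<open>Each bad interval contributes at least \<open>\<eta>\<close> times its length
      to the Henstock sum, so the tolerance \<open>\<eta> * e\<close> keeps the total length below
      \<open>e\<close>.\<close>
    obtain \<gamma> where "gauge \<gamma>" and \<gamma>: "\<And>p. \<lbrakk>p tagged_partial_division_of (cbox a b); \<gamma> fine p\<rbrakk> \<Longrightarrow>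
             sum (\<lambda>(x,k). norm(measure lborel k *\<^sub>R f x - integral k f)) p < \<eta> * e"
      using Henstock_lemma[of f a b "\<eta> * e"] f \<eta> \<open>e > 0\<close> by (auto simp: cbox_interval)
    define I where "I = (\<lambda>(x,y). {min x y..max x (y::real)})"
    \<comment> \<open>The covering family is indexed by pairs because the tag \<open>x\<close> is an
      endpoint of its interval and could not be read off from the ball alone.\<close>
    define K where "K = {(x,y). x \<in> {a..b} \<and> Q \<eta> x y \<and> I (x,y) \<subseteq> \<gamma> x}"
    define c where "c = (\<lambda>(x,y). (x + y) / (2::real))"
    define r where "r = (\<lambda>(x,y). \<bar>y - x\<bar> / (2::real))"
    have I_cball: "I i = cball (c i) (r i)" for i
      by (cases i) (auto simp: I_def c_def r_def cball_eq_atLeastAtMost min_def max_def field_simps)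
    obtain C where C: "countable C" "C \<subseteq> K"
       "pairwise (\<lambda>i j. disjnt (cball (c i) (r i)) (cball (c j) (r j))) C"
       "negligible (E \<eta> - (\<Union>i \<in> C. cball (c i) (r i)))"
    proof (rule Vitali_covering_theorem_cballs[of K r "E \<eta>" c])
      show "0 < r i" if "i \<in> K" for i
        using that by (auto simp: K_def r_def Q_def)
    next
      fix x d :: real assume x: "x \<in> E \<eta>" and "0 < d"
      obtain \<delta> where "\<delta> > 0" "ball x \<delta> \<subseteq> \<gamma> x"
        using \<open>gauge \<gamma>\<close> openE[of "\<gamma> x" x] unfolding gauge_def by blast
      obtain y where y: "\<bar>y - x\<bar> < min \<delta> d" "Q \<eta> x y"
        using x \<open>\<delta> > 0\<close> \<open>d > 0\<close> unfolding E_def by (auto dest!: spec[of _ "min \<delta> d"])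
      have "I (x,y) \<subseteq> ball x \<delta>"
        using y by (auto simp: I_def dist_real_def)
      then have "(x,y) \<in> K"
        using y x \<open>ball x \<delta> \<subseteq> \<gamma> x\<close> by (auto simp: K_def E_def)
      moreover have "x \<in> I (x,y)" by (auto simp: I_def)
      moreover have "r (x,y) < d" using y by (auto simp: r_def)
      ultimately show "\<exists>i. i \<in> K \<and> x \<in> cball (c i) (r i) \<and> r i < d"
        unfolding I_cball[symmetric] by blast
    qed
    have disj: "I i \<inter> I j = {}" if "i \<in> C" "j \<in> C" "i \<noteq> j" for i j
      using C(3) that unfolding I_cball pairwise_def disjnt_def by blast
    have ne: "fst i \<in> I i" for i by (cases i) (auto simp: I_def)
    \<comment> \<open>Henstock's estimate concerns finite families only. The bound does not depend
      on \<open>D\<close>, so it passes to the countable union over \<open>C\<close>.\<close>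
    have bound: "measure lebesgue (\<Union>i\<in>D. I i) \<le> e" if D: "D \<subseteq> C" "finite D" for D
    proof -
      define p where "p = (\<lambda>i. (fst i, I i)) ` D"
      have inj: "inj_on (\<lambda>i. (fst i, I i)) D"
        using disj ne D unfolding inj_on_def by fastforce
      have "p tagged_partial_division_of cbox a b"
        unfolding tagged_partial_division_of_def
      proof (intro conjI allI impI)
        show "finite p" using D by (simp add: p_def)
      next
        fix x k assume "(x, k) \<in> p"
        then obtain i where i: "i \<in> D" "x = fst i" "k = I i" by (auto simp: p_def)
        show "x \<in> k" using i ne by simp
        have "i \<in> K" using i D C(2) by blast
        then show "k \<subseteq> cbox a b" using i by (cases i) (auto simp: K_def Q_def I_def)
        show "\<exists>a b. k = cbox a b" using i by (cases i) (auto simp: I_def cbox_interval)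
      next
        fix x1 k1 x2 k2 assume a: "(x1, k1) \<in> p \<and> (x2, k2) \<in> p \<and> (x1, k1) \<noteq> (x2, k2)"
        then obtain i j where ij: "i \<in> D" "x1 = fst i" "k1 = I i" "j \<in> D" "x2 = fst j" "k2 = I j"
          by (auto simp: p_def)
        with a have "i \<noteq> j" by auto
        with disj ij D have "k1 \<inter> k2 = {}" by blast
        then show "interior k1 \<inter> interior k2 = {}"
          using interior_subset by blast
      qed
      moreover have "\<gamma> fine p"
        using D C(2) by (fastforce simp: fine_def p_def K_def)
      ultimately have "sum (\<lambda>(x,k). norm(measure lborel k *\<^sub>R f x - integral k f)) p < \<eta> * e"
        by (rule \<gamma>)
      also have "sum (\<lambda>(x,k). norm(measure lborel k *\<^sub>R f x - integral k f)) p
          = (\<Sum>i\<in>D. norm (measure lborel (I i) *\<^sub>R f (fst i) - integral (I i) f))"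
        unfolding p_def by (subst sum.reindex[OF inj]) simp
      finally have lt: "(\<Sum>i\<in>D. norm (measure lborel (I i) *\<^sub>R f (fst i) - integral (I i) f)) < \<eta> * e" .
      have "\<eta> * measure lborel (I i) \<le> norm (measure lborel (I i) *\<^sub>R f (fst i) - integral (I i) f)" if "i \<in> D" for i
      proof -
        obtain x y where i: "i = (x,y)" by (cases i)
        have xy: "x \<in> {a..b}" "Q \<eta> x y" using that D C(2) i by (auto simp: K_def)
        show ?thesis
        proof (cases "x \<le> y")
          case True
          then show ?thesis using xy int_diff[of x y]
            by (auto simp: i I_def Q_def norm_minus_commute)
        next
          case False
          then have "norm ((x - y) *\<^sub>R f x - (F x - F y)) = norm (F y - F x - (y - x) *\<^sub>R f x)"
            by (simp add: algebra_simps)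
          then show ?thesis using xy int_diff[of y x] False
            by (auto simp: i I_def Q_def)
        qed
      qed
      then have "(\<Sum>i\<in>D. \<eta> * measure lborel (I i)) \<le> (\<Sum>i\<in>D. norm (measure lborel (I i) *\<^sub>R f (fst i) - integral (I i) f))"
        by (rule sum_mono)
      with lt have "\<eta> * (\<Sum>i\<in>D. measure lborel (I i)) < \<eta> * e"
        by (simp add: sum_distrib_left)
      then have "(\<Sum>i\<in>D. measure lborel (I i)) < e" using \<eta> by simp
      moreover have "measure lebesgue (\<Union>i\<in>D. I i) \<le> (\<Sum>i\<in>D. measure lebesgue (I i))"
        by (rule measure_UNION_le[OF D(2)]) (simp add: I_cball)
      moreover have "(\<Sum>i\<in>D. measure lebesgue (I i)) = (\<Sum>i\<in>D. measure lborel (I i))"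
        by (intro sum.cong) (auto simp: I_cball)
      ultimately show ?thesis by linarith
    qed
    have m: "(\<Union>i\<in>C. I i) \<in> lmeasurable" "measure lebesgue (\<Union>i\<in>C. I i) \<le> e"
      using fmeasurable_UN_bound[OF C(1) _ bound] measure_UN_bound[OF C(1) _ bound] by (simp_all add: I_cball)
    show "\<exists>T. E \<eta> \<subseteq> T \<and> T \<in> lmeasurable \<and> measure lebesgue T \<le> e"
    proof (intro exI conjI)
      let ?N = "E \<eta> - (\<Union>i\<in>C. I i)"
      have N: "negligible ?N" using C(4) by (simp add: I_cball)
      show "E \<eta> \<subseteq> (\<Union>i\<in>C. I i) \<union> ?N" by blast
      show "(\<Union>i\<in>C. I i) \<union> ?N \<in> lmeasurable" 
        by (intro fmeasurable.Un m(1) negligible_imp_measurable[OF N])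
      have "measure lebesgue ((\<Union>i\<in>C. I i) \<union> ?N) \<le> measure lebesgue (\<Union>i\<in>C. I i) + measure lebesgue ?N"
        by (intro measure_Un_le fmeasurableD[OF m(1)] negligible_imp_sets[OF N])
      then show "measure lebesgue ((\<Union>i\<in>C. I i) \<union> ?N) \<le> e"
        using m negligible_imp_measure0[OF N] by linarith
    qed
  qed
  have "negligible (\<Union>n. E (1 / real (Suc n)))"
    by (intro negligible_countable_Union) (auto intro: neg)
  then show ?thesis
  proof (rule negligible_subset, safe)
    fix x assume x: "x \<in> {a..b}" and nd: "\<not> ((\<lambda>t. integral {a..t} f) has_vector_derivative f x) (at x within {a..b})"
    have "\<exists>e>0. \<forall>d>0. \<exists>y\<in>{a..b}. norm (y - x) < d \<and> norm (F y - F x - (y - x) *\<^sub>R f x) > e * norm (y - x)"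
      using nd bounded_linear_scaleR_left unfolding has_vector_derivative_def has_derivative_within_alt F_def[symmetric]
      by (metis not_le)
    then obtain e where "e > 0" and e: "\<And>d. d > 0 \<Longrightarrow> \<exists>y\<in>{a..b}. norm (y - x) < d \<and> norm (F y - F x - (y - x) *\<^sub>R f x) > e * norm (y - x)"
      by blast
    obtain n where n: "1 / real (Suc n) < e"
      using \<open>e > 0\<close> nat_approx_posE by blast
    have "\<exists>y. \<bar>y - x\<bar> < d \<and> Q (1 / real (Suc n)) x y" if "d > 0" for d
    proof -
      obtain y where y: "y \<in> {a..b}" "\<bar>y - x\<bar> < d" "norm (F y - F x - (y - x) *\<^sub>R f x) > e * \<bar>y - x\<bar>"
        using e[OF \<open>d > 0\<close>] by auto
      have "1 / real (Suc n) * \<bar>y - x\<bar> \<le> e * \<bar>y - x\<bar>"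
        using n by (intro mult_right_mono) auto
      then show ?thesis using y unfolding Q_def by (intro exI[of _ y]) fastforce
    qed
    then show "x \<in> (\<Union>n. E (1 / real (Suc n)))"
      using x unfolding E_def by blast
  qed
qed

section \<open>The L-fractional integral\<close>

text \<open>The substitution \<open>s = r + (t - r) * u\<close> reduces this to Euler's Beta
  integral on \<open>{0..1}\<close>. For \<open>r = t\<close> both sides vanish, since
  \<open>0 powr a\<close> is 0 for every \<open>a\<close>. The power rule for \<open>LJ\<close>, the
  semigroup law and the Caputo derivative of powers all rest on it.\<close>

lemma has_integral_Beta_kernel:
  fixes a b r t :: real
  assumes "a > 0" "b > 0" "r \<le> t"
  shows "((\<lambda>s. (s - r) powr (a - 1) * (t - s) powr (b - 1)) has_integral (t - r) powr (a + b - 1) * Beta a b) {r..t}"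
proof (cases "r = t")
  case True
  then show ?thesis by (simp add: has_integral_refl)
next
  case False
  define m where "m = 1 / (t - r)"
  have m: "m > 0" using False assms by (simp add: m_def)
  have "((\<lambda>s. (m *\<^sub>R s + (- r * m)) powr (a - 1) * (1 - (m *\<^sub>R s + (- r * m))) powr (b - 1))
      has_integral (Beta a b /\<^sub>R m ^ DIM(real))) (cbox ((0 - (- r * m)) /\<^sub>R m) ((1 - (- r * m)) /\<^sub>R m))"
    using has_integral_affinity'[OF _ m, of "\<lambda>t. t powr (a - 1) * (1 - t) powr (b - 1)" "Beta a b" 0 1 "- r * m"]
      has_integral_Beta_real[OF assms(1,2)] by (simp add: cbox_interval)
  moreover have "(0 - (- r * m)) /\<^sub>R m = r" "(1 - (- r * m)) /\<^sub>R m = t"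
    using False by (auto simp: m_def field_simps)
  ultimately have "((\<lambda>s. (m * s - r * m) powr (a - 1) * (1 - (m * s - r * m)) powr (b - 1))
      has_integral (Beta a b / m)) {r..t}"
    by (simp add: cbox_interval field_simps)
  then have *: "((\<lambda>s. (t - r) powr (a + b - 2) * ((m * s - r * m) powr (a - 1) * (1 - (m * s - r * m)) powr (b - 1)))
      has_integral (t - r) powr (a + b - 2) * (Beta a b / m)) {r..t}"
    by (rule has_integral_mult_right)
  moreover have "(t - r) powr (a + b - 2) * (Beta a b / m) = (t - r) powr (a + b - 1) * Beta a b"
  proof -
    have "(t - r) powr (a + b - 1) = (t - r) powr (a + b - 2) * (t - r) powr 1"
      by (subst powr_add[symmetric]) simp
    then show ?thesis using False assms by (simp add: m_def)
  qed
  moreover have "(t - r) powr (a + b - 2) * ((m * s - r * m) powr (a - 1) * (1 - (m * s - r * m)) powr (b - 1))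
     = (s - r) powr (a - 1) * (t - s) powr (b - 1)" if "s \<in> {r..t}" for s
  proof -
    have "m * s - r * m = (s - r) / (t - r)"
      by (simp add: m_def diff_divide_distrib)
    moreover from this have "1 - (m * s - r * m) = (t - s) / (t - r)"
      using False by (simp add: divide_simps) (simp add: algebra_simps)
    moreover have "(t - r) powr (a + b - 2) = (t - r) powr (a - 1) * (t - r) powr (b - 1)"
      by (subst powr_add[symmetric]) (simp add: algebra_simps)
    ultimately show ?thesis using False that assms by (simp add: powr_divide)
  qed
  ultimately show ?thesis
    using has_integral_eq[OF _ *] by simp
qed

section \<open>Growth of the Mittag-Leffler coefficients\<close>

lemma mlf_coeff_pos: "\<alpha> < 1 \<Longrightarrow> mlf_coeff \<alpha> n > 0"
  unfolding mlf_coeff_def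
  by (intro mult_pos_pos zero_less_power prod_pos) (auto intro!: divide_pos_pos Gamma_real_pos)

lemma mlf_coeff_0 [simp]: "mlf_coeff \<alpha> 0 = 1"
  by (simp add: mlf_coeff_def)

lemma mlf_coeff_ratio:
  assumes "\<alpha> < 1"
  shows "mlf_coeff \<alpha> n / mlf_coeff \<alpha> (Suc n) = Gamma (real n + 2 - \<alpha>) / (Gamma (2 - \<alpha>) * Gamma (real n + 2))"
proof -
  have "mlf_coeff \<alpha> (Suc n) = mlf_coeff \<alpha> n * (Gamma (2 - \<alpha>) * (Gamma (real n + 2) / Gamma (real n + 2 - \<alpha>)))"
    by (simp add: mlf_coeff_def algebra_simps)
  then show ?thesis using mlf_coeff_pos[OF assms, of n] by simp
qed

text \<open>\<open>n + 2 - \<alpha>\<close> is the convex combination of \<open>n + 2\<close> and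
  \<open>n + 1\<close> with weights \<open>1 - \<alpha>\<close> and \<open>\<alpha>\<close>;
  log-convexity of \<open>Gamma\<close> and its functional equation give the decay. The estimate
  serves twice: for the limit 0 and for a bound uniform in \<open>n\<close>.\<close>

lemma mlf_coeff_ratio_le:
  assumes "0 < \<alpha>" "\<alpha> < 1"
  shows "mlf_coeff \<alpha> n / mlf_coeff \<alpha> (Suc n) \<le> real (Suc n) powr (-\<alpha>) / Gamma (2 - \<alpha>)"
proof -
  let ?n = "real n"
  have pos: "Gamma (?n + 2 - \<alpha>) > 0" "Gamma (?n + 2) > 0" "Gamma (?n + 1) > 0" "Gamma (2 - \<alpha>) > 0"
    using assms by (auto intro!: Gamma_real_pos)
  have "(ln \<circ> Gamma) ((1 - \<alpha>) *\<^sub>R (?n + 2) + \<alpha> *\<^sub>R (?n + 1)) \<le>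
      (1 - \<alpha>) * (ln \<circ> Gamma) (?n + 2) + \<alpha> * (ln \<circ> Gamma) (?n + 1)"
    using assms by (intro convex_onD[OF log_convex_Gamma_real]) auto
  moreover have "(1 - \<alpha>) *\<^sub>R (?n + 2) + \<alpha> *\<^sub>R (?n + 1) = ?n + 2 - \<alpha>"
    by (simp add: algebra_simps)
  moreover have "Gamma (?n + 2) = (?n + 1) * Gamma (?n + 1)"
    using Gamma_plus1[of "?n + 1"] by (auto simp: add.commute nonpos_Ints_def)
  then have "ln (Gamma (?n + 2)) = ln (?n + 1) + ln (Gamma (?n + 1))"
    using ln_mult_pos[of "?n + 1" "Gamma (?n + 1)"] pos(3) by simp
  ultimately have "ln (Gamma (?n + 2 - \<alpha>)) \<le> ln (Gamma (?n + 2)) - \<alpha> * ln (?n + 1)"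
    by (simp add: algebra_simps)
  also have "\<dots> = ln (Gamma (?n + 2) * (?n + 1) powr (-\<alpha>))"
    using pos(2) by (simp add: ln_mult_pos ln_powr)
  finally have "Gamma (?n + 2 - \<alpha>) \<le> Gamma (?n + 2) * (?n + 1) powr (-\<alpha>)"
    using pos by (subst (asm) ln_le_cancel_iff) auto
  then show ?thesis
    using pos unfolding mlf_coeff_ratio[OF assms(2)] by (simp add: field_simps)
qed

lemma mlf_coeff_ratio_tendsto_0:
  assumes "0 < \<alpha>" "\<alpha> < 1"
  shows "(\<lambda>n. mlf_coeff \<alpha> n / mlf_coeff \<alpha> (Suc n)) \<longlonglongrightarrow> 0"
proof (rule tendsto_sandwich[OF _ _ tendsto_const])
  have "(\<lambda>n. real (Suc n) powr (-\<alpha>)) \<longlonglongrightarrow> 0"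
    using assms by (intro tendsto_neg_powr filterlim_compose[OF filterlim_real_sequentially] filterlim_Suc) auto
  then show "(\<lambda>n. real (Suc n) powr (-\<alpha>) / Gamma (2 - \<alpha>)) \<longlonglongrightarrow> 0"
    by (rule tendsto_divide_zero)
qed (use assms mlf_coeff_ratio_le mlf_coeff_pos in \<open>auto intro!: always_eventually simp: less_imp_le\<close>)

text \<open>Ratio test, with ratios tending to 0 for every \<open>r\<close>. With \<open>r\<close> a
  bound for matrix growth times \<open>T\<close> this is the common majorant of the series in the
  solution.\<close>

lemma summable_mlf_series:
  fixes r :: real
  assumes "0 < \<alpha>" "\<alpha> < 1" "0 \<le> r"
  shows "summable (\<lambda>n. r ^ n / mlf_coeff \<alpha> n)"
proof -
  have "(\<lambda>n. r * (mlf_coeff \<alpha> n / mlf_coeff \<alpha> (Suc n))) \<longlonglongrightarrow> r * 0"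
    by (intro tendsto_mult mlf_coeff_ratio_tendsto_0 assms tendsto_const)
  then have "eventually (\<lambda>n. r * (mlf_coeff \<alpha> n / mlf_coeff \<alpha> (Suc n)) < 1/2) sequentially"
    by (intro order_tendstoD(2)[where y = "r * 0"]) auto
  then obtain N where N: "\<And>n. n \<ge> N \<Longrightarrow> r * (mlf_coeff \<alpha> n / mlf_coeff \<alpha> (Suc n)) < 1/2"
    unfolding eventually_sequentially by blast
  show ?thesis
  proof (rule summable_ratio_test[of "1/2" N])
    fix n assume "n \<ge> N"
    have pos: "mlf_coeff \<alpha> n > 0" "mlf_coeff \<alpha> (Suc n) > 0" using mlf_coeff_pos assms by auto
    have "r ^ Suc n / mlf_coeff \<alpha> (Suc n) = (r * (mlf_coeff \<alpha> n / mlf_coeff \<alpha> (Suc n))) * (r ^ n / mlf_coeff \<alpha> n)"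
      using pos by simp
    also have "\<dots> \<le> 1/2 * (r ^ n / mlf_coeff \<alpha> n)"
      using N[OF \<open>n \<ge> N\<close>] pos assms by (intro mult_right_mono) auto
    finally show "norm (r ^ Suc n / mlf_coeff \<alpha> (Suc n)) \<le> 1/2 * norm (r ^ n / mlf_coeff \<alpha> n)"
      using pos assms by simp
  qed simp
qed

section \<open>Action on powers, linearity and continuity of the L-fractional integral\<close>

lemma LJ_kernel_has_integral:
  assumes "0 < \<alpha>" "\<alpha> < 1" "0 \<le> t"
  shows "((\<lambda>s. ((t - s) powr (\<alpha> - 1) * s powr (1 - \<alpha>)) * s ^ n) has_integral
           Gamma \<alpha> * Gamma (2 - \<alpha>) * (mlf_coeff \<alpha> n / mlf_coeff \<alpha> (Suc n) * t ^ Suc n)) {0..t}"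
proof -
  \<comment> \<open>The parameters \<open>n + 2 - \<alpha>\<close> and \<open>\<alpha>\<close> make
    the resulting exponent \<open>n + 1\<close>, and their Beta value is
    \<open>Gamma \<alpha> * Gamma (2 - \<alpha>)\<close> times the quotient of consecutive
    coefficients.\<close>
  have *: "((\<lambda>s. (s - 0) powr ((real n + 2 - \<alpha>) - 1) * (t - s) powr (\<alpha> - 1)) has_integral
      (t - 0) powr ((real n + 2 - \<alpha>) + \<alpha> - 1) * Beta (real n + 2 - \<alpha>) \<alpha>) {0..t}"
    using assms by (intro has_integral_Beta_kernel) auto
  have "Gamma (2 - \<alpha>) > 0" using assms by (intro Gamma_real_pos) auto
  then have "Gamma (2 - \<alpha>) \<noteq> 0" by simp
  then have "(t - 0) powr ((real n + 2 - \<alpha>) + \<alpha> - 1) * Beta (real n + 2 - \<alpha>) \<alpha>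
    = Gamma \<alpha> * Gamma (2 - \<alpha>) * (mlf_coeff \<alpha> n / mlf_coeff \<alpha> (Suc n) * t ^ Suc n)"
    using powr_realpow'[OF assms(3), of "Suc n"] assms unfolding mlf_coeff_ratio[OF assms(2)] Beta_def
    by (simp add: add.commute)
  moreover have "(s - 0) powr (real n + 2 - \<alpha> - 1) * (t - s) powr (\<alpha> - 1) = ((t - s) powr (\<alpha> - 1) * s powr (1 - \<alpha>)) * s ^ n"
    if "s \<in> {0..t}" for s
  proof -
    have "s powr (real n + 2 - \<alpha> - 1) = s powr (1 - \<alpha>) * s ^ n"
    \<comment> \<open>At \<open>s = 0\<close> both sides are 0, also for \<open>n = 0\<close> where
      \<open>0 ^ 0 = 1\<close>, because the factor \<open>0 powr (1 - \<alpha>)\<close> is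
      0.\<close>
    proof (cases "s = 0")
      case False
      then have "s powr (real n + 2 - \<alpha> - 1) = s powr ((1 - \<alpha>) + real n)" by (simp add: algebra_simps)
      also have "\<dots> = s powr (1 - \<alpha>) * s ^ n"
        using False that by (subst powr_add) (simp add: powr_realpow)
      finally show ?thesis .
    qed auto
    then show ?thesis by simp
  qed
  ultimately show ?thesis
    using has_integral_eq[OF _ *] by simp
qed

text \<open>The scalar kernel is nonnegative and integrable, and a continuous \<open>y\<close> is
  bounded and measurable. Absolute integrability, rather than gauge integrability alone, later
  permits the passage to the Bochner integral.\<close>

lemma LJ_kernel_absolutely_integrable:
  fixes y :: "real \<Rightarrow> 'a::euclidean_space"
  assumes "0 < \<alpha>" "\<alpha> < 1" "0 \<le> t" "continuous_on {0..t} y"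
  shows "(\<lambda>s. ((t - s) powr (\<alpha> - 1) * s powr (1 - \<alpha>)) *\<^sub>R y s) absolutely_integrable_on {0..t}"
proof -
  have "(\<lambda>s. (t - s) powr (\<alpha> - 1) * s powr (1 - \<alpha>)) absolutely_integrable_on {0..t}"
    using LJ_kernel_has_integral[OF assms(1-3), of 0]
    by (intro nonnegative_absolutely_integrable_1) (auto simp: has_integral_iff)
  moreover have "bilinear (\<lambda>(v::'a) (c::real). c *\<^sub>R v)"
    by (auto simp: bilinear_def linear_iff algebra_simps)
  moreover have "y \<in> borel_measurable (lebesgue_on {0..t})"
    using assms(4) by (intro continuous_imp_measurable_on_sets_lebesgue) auto
  moreover have "bounded (y ` {0..t})"
    using assms(4) by (intro compact_imp_bounded compact_continuous_image) auto
  ultimately show ?thesis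
    by (intro absolutely_integrable_bounded_measurable_product[where h = "\<lambda>v c. c *\<^sub>R v"]) auto
qed

lemma LJ_kernel_integrable:
  fixes y :: "real \<Rightarrow> 'a::euclidean_space"
  assumes "0 < \<alpha>" "\<alpha> < 1" "0 \<le> t" "continuous_on {0..t} y"
  shows "(\<lambda>s. ((t - s) powr (\<alpha> - 1) * s powr (1 - \<alpha>)) *\<^sub>R y s) integrable_on {0..t}"
  using LJ_kernel_absolutely_integrable[OF assms] set_lebesgue_integral_eq_integral(1) by blast

lemma LJ_cong: "(\<And>s. s \<in> {0..t} \<Longrightarrow> y s = z s) \<Longrightarrow> LJ \<alpha> y t = LJ \<alpha> z t"
  unfolding LJ_def by (metis (no_types, lifting) Henstock_Kurzweil_Integration.integral_cong)

lemma LJ_power: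
  fixes v :: "'a::euclidean_space"
  assumes "0 < \<alpha>" "\<alpha> < 1" "0 \<le> t"
  shows "LJ \<alpha> (\<lambda>s. s ^ n *\<^sub>R v) t = (mlf_coeff \<alpha> n / mlf_coeff \<alpha> (Suc n) * t ^ Suc n) *\<^sub>R v"
proof -
  have "Gamma \<alpha> > 0" "Gamma (2 - \<alpha>) > 0" using assms by (auto intro!: Gamma_real_pos)
  then show ?thesis
    using has_integral_scaleR_left[OF LJ_kernel_has_integral[OF assms, of n], of v]
    by (simp add: LJ_def has_integral_iff)
qed

lemma LJ_add:
  fixes y z :: "real \<Rightarrow> 'a::euclidean_space"
  assumes "0 < \<alpha>" "\<alpha> < 1" "0 \<le> t" "continuous_on {0..t} y" "continuous_on {0..t} z"
  shows "LJ \<alpha> (\<lambda>s. y s + z s) t = LJ \<alpha> y t + LJ \<alpha> z t"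
  using Henstock_Kurzweil_Integration.integral_add[OF LJ_kernel_integrable[OF assms(1-4)] LJ_kernel_integrable[OF assms(1-3,5)]]
  by (simp add: LJ_def scaleR_add_right)

lemma LJ_bounded_linear:
  fixes y :: "real \<Rightarrow> 'a::euclidean_space" and f :: "'a \<Rightarrow> 'b::euclidean_space"
  assumes "0 < \<alpha>" "\<alpha> < 1" "0 \<le> t" "continuous_on {0..t} y" "bounded_linear f"
  shows "LJ \<alpha> (\<lambda>s. f (y s)) t = f (LJ \<alpha> y t)"
  using integral_linear[OF LJ_kernel_integrable[OF assms(1-4)] assms(5)]
  by (simp add: LJ_def o_def linear_simps(5)[OF assms(5)])

lemma LJ_diff:
  fixes y z :: "real \<Rightarrow> 'a::euclidean_space"
  assumes "0 < \<alpha>" "\<alpha> < 1" "0 \<le> t" "continuous_on {0..t} y" "continuous_on {0..t} z"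
  shows "LJ \<alpha> (\<lambda>s. y s - z s) t = LJ \<alpha> y t - LJ \<alpha> z t"
  using Henstock_Kurzweil_Integration.integral_diff[OF LJ_kernel_integrable[OF assms(1-4)] LJ_kernel_integrable[OF assms(1-3,5)]]
  by (simp add: LJ_def scaleR_diff_right)

lemma LJ_sum:
  fixes y :: "'i \<Rightarrow> real \<Rightarrow> 'a::euclidean_space"
  assumes "0 < \<alpha>" "\<alpha> < 1" "0 \<le> t" "\<And>i. i \<in> I \<Longrightarrow> continuous_on {0..t} (y i)" "finite I"
  shows "LJ \<alpha> (\<lambda>s. \<Sum>i\<in>I. y i s) t = (\<Sum>i\<in>I. LJ \<alpha> (y i) t)"
  using integral_sum[OF assms(5) LJ_kernel_integrable[OF assms(1-4)]]
  by (simp add: LJ_def scaleR_sum_right)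

text \<open>The kernel is nonnegative, so the bound is inherited by the integral of
  \<open>B * s ^ n\<close>, which the power rule evaluates. Retaining the power of \<open>s\<close>
  is what makes iterated bounds decay like \<open>1 / mlf_coeff \<alpha> n\<close>.\<close>

lemma norm_LJ_le:
  fixes y :: "real \<Rightarrow> 'a::euclidean_space"
  assumes "0 < \<alpha>" "\<alpha> < 1" "0 \<le> t" "continuous_on {0..t} y"
    and le: "\<And>s. s \<in> {0..t} \<Longrightarrow> norm (y s) \<le> B * s ^ n"
  shows "norm (LJ \<alpha> y t) \<le> B * (mlf_coeff \<alpha> n / mlf_coeff \<alpha> (Suc n) * t ^ Suc n)"
proof -
  have pos: "Gamma \<alpha> * Gamma (2 - \<alpha>) > 0" using assms by (auto intro!: mult_pos_pos Gamma_real_pos)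
  have "norm (integral {0..t} (\<lambda>s. ((t - s) powr (\<alpha> - 1) * s powr (1 - \<alpha>)) *\<^sub>R y s))
     \<le> integral {0..t} (\<lambda>s. ((t - s) powr (\<alpha> - 1) * s powr (1 - \<alpha>) * s ^ n) * B)"
  proof (rule integral_norm_bound_integral[OF LJ_kernel_integrable[OF assms(1-4)]])
    show "(\<lambda>s. ((t - s) powr (\<alpha> - 1) * s powr (1 - \<alpha>) * s ^ n) * B) integrable_on {0..t}"
      by (rule integrable_on_mult_left has_integral_integrable[OF LJ_kernel_has_integral] assms)+
  next
    fix s assume "s \<in> {0..t}"
    then show "norm (((t - s) powr (\<alpha> - 1) * s powr (1 - \<alpha>)) *\<^sub>R y s) \<le> ((t - s) powr (\<alpha> - 1) * s powr (1 - \<alpha>) * s ^ n) * B"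
      using mult_left_mono[OF le[of s], of "(t - s) powr (\<alpha> - 1) * s powr (1 - \<alpha>)"] by (simp add: mult_ac)
  qed
  also have "\<dots> = Gamma \<alpha> * Gamma (2 - \<alpha>) * (mlf_coeff \<alpha> n / mlf_coeff \<alpha> (Suc n) * t ^ Suc n) * B"
    by (intro integral_unique has_integral_mult_left LJ_kernel_has_integral assms)
  finally show ?thesis
    using pos unfolding LJ_def by (simp add: field_simps)
qed

lemma LJ_tendsto:
  fixes y :: "real \<Rightarrow> 'a::euclidean_space"
  assumes "0 < \<alpha>" "\<alpha> < 1" "0 \<le> t" "\<And>n. continuous_on {0..t} (f n)"
    and lim: "uniform_limit {0..t} f y sequentially"
  shows "(\<lambda>n. LJ \<alpha> (f n) t) \<longlonglongrightarrow> LJ \<alpha> y t"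
proof (rule LIMSEQ_I)
  fix e :: real assume "e > 0"
  have y: "continuous_on {0..t} y"
    using uniform_limit_theorem[OF _ lim] assms(4) by auto
  \<comment> \<open>The normalisation gives \<open>LJ \<alpha>\<close> of the constant
    \<open>d\<close> the value \<open>d * t\<close>, since the coefficient quotient at
    \<open>n = 0\<close> is 1; the summand 1 makes the bound strict and covers
    \<open>t = 0\<close>.\<close>
  define d where "d = e / (t + 1)"
  have "d > 0" using \<open>e > 0\<close> assms by (simp add: d_def)
  then obtain N where N: "\<And>n s. n \<ge> N \<Longrightarrow> s \<in> {0..t} \<Longrightarrow> dist (f n s) (y s) < d"
    using lim unfolding uniform_limit_iff eventually_sequentially by blast
  have "norm (LJ \<alpha> (f n) t - LJ \<alpha> y t) < e" if "n \<ge> N" for n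
  proof -
    have pos: "Gamma (2 - \<alpha>) > 0" using assms by (auto intro!: Gamma_real_pos)
    have "norm (LJ \<alpha> (\<lambda>s. f n s - y s) t) \<le> d * (mlf_coeff \<alpha> 0 / mlf_coeff \<alpha> (Suc 0) * t ^ Suc 0)"
      using N[OF that] assms y by (intro norm_LJ_le continuous_intros) (auto simp: dist_norm less_imp_le)
    also have "mlf_coeff \<alpha> 0 / mlf_coeff \<alpha> (Suc 0) = 1"
      unfolding mlf_coeff_ratio[OF assms(2)] using pos Gamma_numeral[of "num.Bit0 num.One", where ?'a = real] by simp
    also have "d * (1 * t ^ Suc 0) < e"
      using \<open>e > 0\<close> assms by (simp add: d_def field_simps)
    finally show ?thesis using LJ_diff[OF assms(1-4) y] by simp
  qed
  then show "\<exists>N. \<forall>n\<ge>N. norm (LJ \<alpha> (f n) t - LJ \<alpha> y t) < e" by blast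
qed

text \<open>Substituting \<open>s = t * u\<close>, the powers \<open>t powr (\<alpha> - 1)\<close>
  and \<open>t powr (1 - \<alpha>)\<close> cancel and only the Jacobian \<open>t\<close> remains.
  Domain and kernel no longer depend on \<open>t\<close>, which opens the way to continuity in
  \<open>t\<close>.\<close>

lemma LJ_rescale:
  fixes y :: "real \<Rightarrow> 'a::euclidean_space"
  assumes "0 < \<alpha>" "\<alpha> < 1" "0 \<le> t" "continuous_on {0..t} y"
  shows "LJ \<alpha> y t = t *\<^sub>R LJ \<alpha> (\<lambda>u. y (t * u)) 1"
proof (cases "t = 0")
  case True
  then show ?thesis by (simp add: LJ_def)
next
  case False
  then have t: "t > 0" using assms by simp
  define I where "I = integral {0..t} (\<lambda>s. ((t - s) powr (\<alpha> - 1) * s powr (1 - \<alpha>)) *\<^sub>R y s)"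
  have "((\<lambda>s. ((t - s) powr (\<alpha> - 1) * s powr (1 - \<alpha>)) *\<^sub>R y s) has_integral I) (cbox 0 t)"
    using LJ_kernel_integrable[OF assms] by (simp add: I_def has_integral_iff cbox_interval)
  from has_integral_affinity'[OF this t, of 0]
  have "((\<lambda>u. ((t - t * u) powr (\<alpha> - 1) * (t * u) powr (1 - \<alpha>)) *\<^sub>R y (t * u)) has_integral (I /\<^sub>R t)) {0..1}"
    using t by (simp add: cbox_interval)
  then have "((\<lambda>u. ((1 - u) powr (\<alpha> - 1) * u powr (1 - \<alpha>)) *\<^sub>R y (t * u)) has_integral (I /\<^sub>R t)) {0..1}"
  proof (rule has_integral_eq[rotated], goal_cases)
    case (1 u)
    have "t - t * u = t * (1 - u)" by (simp add: algebra_simps)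
    then have "(t - t * u) powr (\<alpha> - 1) * (t * u) powr (1 - \<alpha>) = (t powr (\<alpha> - 1) * t powr (1 - \<alpha>)) * ((1 - u) powr (\<alpha> - 1) * u powr (1 - \<alpha>))"
      using t 1 by (simp add: powr_mult)
    also have "t powr (\<alpha> - 1) * t powr (1 - \<alpha>) = 1"
      using t by (simp add: powr_add[symmetric])
    finally show ?case by simp
  qed
  then have "I = t *\<^sub>R integral {0..1} (\<lambda>u. ((1 - u) powr (\<alpha> - 1) * u powr (1 - \<alpha>)) *\<^sub>R y (t * u))"
    using t by (simp add: integral_unique)
  then show ?thesis by (simp add: LJ_def I_def)
qed

text \<open>After rescaling, \<open>t\<close> enters only through \<open>y (t * u)\<close>. Uniform
  continuity of \<open>y\<close> on the compact interval turns convergence of \<open>t\<close> into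
  uniform convergence in \<open>u\<close>, and \<open>LJ_tendsto\<close> applies.\<close>

lemma continuous_on_LJ:
  fixes y :: "real \<Rightarrow> 'a::euclidean_space"
  assumes "0 < \<alpha>" "\<alpha> < 1" "continuous_on {0..T} y"
  shows "continuous_on {0..T} (LJ \<alpha> y)"
proof -
  define G where "G t = LJ \<alpha> (\<lambda>u. y (t * u)) 1" for t
  have cont: "continuous_on {0..1} (\<lambda>u. y (t * u))" if "t \<in> {0..T}" for t
  proof (rule continuous_on_compose2[OF assms(3)])
    show "(*) t ` {0..1} \<subseteq> {0..T}"
      using that by (auto intro: order_trans[OF mult_left_le])
  qed (intro continuous_intros)
  have unif: "uniformly_continuous_on {0..T} y"
    using assms(3) by (intro compact_uniformly_continuous) auto
  have "continuous_on {0..T} G"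
  proof (rule continuous_on_sequentiallyI)
    fix u a assume u: "\<forall>n. u n \<in> {0..T}" and a: "a \<in> {0..T}" and lim: "u \<longlonglongrightarrow> a"
    show "(\<lambda>n. G (u n)) \<longlonglongrightarrow> G a"
      unfolding G_def
    proof (rule LJ_tendsto)
      show "uniform_limit {0..1} (\<lambda>n v. y (u n * v)) (\<lambda>v. y (a * v)) sequentially"
        unfolding uniform_limit_iff
      proof (intro allI impI)
        fix e :: real assume "e > 0"
        then obtain d where "d > 0" and d: "\<And>p q. p \<in> {0..T} \<Longrightarrow> q \<in> {0..T} \<Longrightarrow> dist p q < d \<Longrightarrow> dist (y p) (y q) < e"
          using unif unfolding uniformly_continuous_on_def by metis
        have "eventually (\<lambda>n. dist (u n) a < d) sequentially"
          using lim \<open>d > 0\<close> by (rule tendstoD)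
        then show "\<forall>\<^sub>F n in sequentially. \<forall>v\<in>{0..1}. dist (y (u n * v)) (y (a * v)) < e"
        proof eventually_elim
          case (elim n)
          show ?case
          proof
            fix v :: real assume v: "v \<in> {0..1}"
            have in_T: "p * v \<in> {0..T}" if "p \<in> {0..T}" for p
              using that v mult_left_le[of v p] by (auto intro: order_trans[rotated])
            have "dist (u n * v) (a * v) = dist (u n) a * v"
              using v by (simp add: dist_real_def abs_mult left_diff_distrib[symmetric])
            also have "\<dots> \<le> dist (u n) a" using v by (intro mult_left_le) auto
            finally show "dist (y (u n * v)) (y (a * v)) < e"
              using elim u a by (intro d in_T) auto
          qed
        qed
      qed
    qed (use assms cont u in auto)
  qed
  then have "continuous_on {0..T} (\<lambda>t. t *\<^sub>R G t)"
    by (intro continuous_intros)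
  then show ?thesis
  proof (rule continuous_on_eq)
    fix t assume "t \<in> {0..T}"
    moreover from this have "continuous_on {0..t} y"
      by (intro continuous_on_subset[OF assms(3)]) auto
    ultimately show "t *\<^sub>R G t = LJ \<alpha> y t"
      using LJ_rescale[OF assms(1,2), of t y, symmetric] by (simp add: G_def)
  qed
qed

section \<open>The integral equation\<close>

lemma mat_pow_0 [simp]: "mat_pow A 0 = mat 1"
  by (simp add: mat_pow_def)

lemma mat_pow_Suc: "mat_pow A (Suc n) = A ** mat_pow A n"
  by (simp add: mat_pow_def)

lemma scaleR_matrix_mult: "(t *\<^sub>R A) ** B = t *\<^sub>R (A ** B)" "A ** (t *\<^sub>R B) = t *\<^sub>R (A ** B)"
  for A :: "complex^'n^'m" and B :: "complex^'k^'n"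
  by (simp_all add: vec_eq_iff matrix_matrix_mult_def scaleR_sum_right)

lemma mat_pow_scaleR: "mat_pow (t *\<^sub>R A) n = t ^ n *\<^sub>R mat_pow A n"
  by (induction n) (simp_all add: mat_pow_Suc scaleR_matrix_mult mult.commute)

lemma scaleR_matrix_vector_mult: "(t *\<^sub>R A) *v v = t *\<^sub>R (A *v v)" "A *v (t *\<^sub>R v) = t *\<^sub>R (A *v v)"
  for A :: "complex^'n^'m"
  by (simp_all add: vec_eq_iff matrix_vector_mult_def scaleR_sum_right)

lemma bounded_linear_matrix_vector_mult_left: "bounded_linear (\<lambda>A. A *v v)"
  for v :: "complex^'n"
  unfolding linear_conv_bounded_linear[symmetric]
  by (intro linearI) (simp_all add: matrix_vector_mult_add_rdistrib scaleR_matrix_vector_mult)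

text \<open>Bounded linearity of multiplication by \<open>A\<close> on matrices and on vectors
  yields two constants, merged into one \<open>K\<close> by a maximum. The norm of
  \<open>complex^'d^'d\<close> is not an operator norm, so \<open>norm (mat 1)\<close> stays in the
  first bound.\<close>

lemma mat_pow_norm_bound:
  fixes A :: "complex^'d^'d"
  obtains K where "K > 0" "\<And>n. norm (mat_pow A n) \<le> K ^ n * norm (mat 1 :: complex^'d^'d)"
    "\<And>n v. norm (mat_pow A n *v v) \<le> K ^ n * norm v"
proof -
  have "bounded_linear (\<lambda>B :: complex^'d^'d. A ** B)"
    unfolding linear_conv_bounded_linear[symmetric]
    by (intro linearI) (simp_all add: matrix_add_ldistrib scaleR_matrix_mult)
  then obtain K1 where K1: "K1 > 0" "\<And>B :: complex^'d^'d. norm (A ** B) \<le> norm B * K1"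
    using bounded_linear.pos_bounded by blast
  obtain K2 where K2: "K2 > 0" "\<And>v. norm (A *v v) \<le> norm v * K2"
    using bounded_linear.pos_bounded[OF matrix_vector_mul_bounded_linear[of A]] by blast
  define K where "K = max K1 K2"
  have K: "norm (A ** B) \<le> K * norm B" "norm (A *v v) \<le> K * norm v" for B :: "complex^'d^'d" and v
    using K1(2)[of B] K2(2)[of v] mult_right_mono[of K1 K "norm B"] mult_right_mono[of K2 K "norm v"]
    by (simp_all add: K_def mult.commute)
  have "K > 0" using K1 by (simp add: K_def)
  show ?thesis
  proof
    show "K > 0" by fact
    show "norm (mat_pow A n) \<le> K ^ n * norm (mat 1 :: complex^'d^'d)" for n
    proof (induction n)
      case (Suc n)
      have "norm (mat_pow A (Suc n)) \<le> K * norm (mat_pow A n)"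
        using K by (simp add: mat_pow_Suc)
      also have "\<dots> \<le> K * (K ^ n * norm (mat 1 :: complex^'d^'d))"
        using Suc \<open>K > 0\<close> by simp
      finally show ?case by (simp add: mult.assoc)
    qed auto
    show "norm (mat_pow A n *v v) \<le> K ^ n * norm v" for n v
    proof (induction n)
      case (Suc n)
      have "norm (mat_pow A (Suc n) *v v) \<le> K * norm (mat_pow A n *v v)"
        using K by (simp add: mat_pow_Suc matrix_vector_mul_assoc[symmetric])
      also have "\<dots> \<le> K * (K ^ n * norm v)"
        using Suc \<open>K > 0\<close> by simp
      finally show ?case by (simp add: mult.assoc)
    qed auto
  qed
qed

section \<open>Iterates, series and the solution of the integral equation\<close>

lemma LJ_iter_Suc: "LJ_iter (Suc n) \<alpha> y = LJ \<alpha> (LJ_iter n \<alpha> y)"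
  by (simp add: LJ_iter_def)

lemma continuous_on_LJ_iter:
  fixes y :: "real \<Rightarrow> 'a::euclidean_space"
  assumes "0 < \<alpha>" "\<alpha> < 1" "continuous_on {0..T} y"
  shows "continuous_on {0..T} (LJ_iter n \<alpha> y)"
proof (induction n)
  case 0
  then show ?case using assms by (simp add: LJ_iter_def)
next
  case (Suc n)
  then show ?case using assms by (simp add: LJ_iter_Suc continuous_on_LJ)
qed

text \<open>Each step through \<open>norm_LJ_le\<close> contributes one quotient of consecutive
  coefficients, and the product of these telescopes.\<close>

lemma norm_LJ_iter_le:
  fixes y :: "real \<Rightarrow> 'a::euclidean_space"
  assumes "0 < \<alpha>" "\<alpha> < 1" "continuous_on {0..T} y"
    and B: "\<And>s. s \<in> {0..T} \<Longrightarrow> norm (y s) \<le> B"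
  shows "t \<in> {0..T} \<Longrightarrow> norm (LJ_iter n \<alpha> y t) \<le> B / mlf_coeff \<alpha> n * t ^ n"
proof (induction n arbitrary: t)
  case 0
  then show ?case using B by (simp add: LJ_iter_def)
next
  case (Suc n)
  have "norm (LJ_iter (Suc n) \<alpha> y t) \<le> B / mlf_coeff \<alpha> n * (mlf_coeff \<alpha> n / mlf_coeff \<alpha> (Suc n) * t ^ Suc n)"
    unfolding LJ_iter_Suc
    using Suc by (intro norm_LJ_le assms continuous_on_subset[OF continuous_on_LJ_iter[OF assms(1-3)]]) auto
  then show ?case
    using mlf_coeff_pos[OF assms(2), of n] by simp
qed

text \<open>By the M-test the partial sums converge uniformly, so the limit may be taken through
  \<open>LJ\<close> by \<open>LJ_tendsto\<close>.\<close>

lemma LJ_suminf: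
  fixes f :: "nat \<Rightarrow> real \<Rightarrow> 'a::euclidean_space"
  assumes "0 < \<alpha>" "\<alpha> < 1" "0 \<le> t" "\<And>n. continuous_on {0..t} (f n)"
    and "\<And>n s. s \<in> {0..t} \<Longrightarrow> norm (f n s) \<le> M n" "summable M"
  shows "(\<lambda>n. LJ \<alpha> (f n) t) sums LJ \<alpha> (\<lambda>s. \<Sum>n. f n s) t"
proof -
  have "uniform_limit {0..t} (\<lambda>n s. \<Sum>i<n. f i s) (\<lambda>s. \<Sum>i. f i s) sequentially"
    by (rule Weierstrass_m_test[OF assms(5,6)])
  then have "(\<lambda>n. LJ \<alpha> (\<lambda>s. \<Sum>i<n. f i s) t) \<longlonglongrightarrow> LJ \<alpha> (\<lambda>s. \<Sum>i. f i s) t"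
    by (intro LJ_tendsto assms continuous_intros)
  moreover have "LJ \<alpha> (\<lambda>s. \<Sum>i<n. f i s) t = (\<Sum>i<n. LJ \<alpha> (f i) t)" for n
    by (intro LJ_sum assms) auto
  ultimately show ?thesis by (simp add: sums_def)
qed

lemma continuous_on_suminf:
  fixes f :: "nat \<Rightarrow> 'b::topological_space \<Rightarrow> 'a::banach"
  assumes "\<And>n. continuous_on S (f n)"
    and "\<And>n s. s \<in> S \<Longrightarrow> norm (f n s) \<le> M n" "summable M"
  shows "continuous_on S (\<lambda>s. \<Sum>n. f n s)"
proof (rule uniform_limit_theorem[OF _ Weierstrass_m_test[OF assms(2,3)]])
  show "\<forall>\<^sub>F n in sequentially. continuous_on S (\<lambda>s. \<Sum>i<n. f i s)"
    by (intro always_eventually allI continuous_intros assms)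
qed auto

lemma summable_mlf_term:
  fixes A :: "complex^'d^'d"
  assumes "0 < \<alpha>" "\<alpha> < 1" "0 \<le> t"
  shows "summable (mlf_term \<alpha> (t *\<^sub>R A))"
proof -
  obtain K where K: "K > 0" "\<And>n. norm (mat_pow A n) \<le> K ^ n * norm (mat 1 :: complex^'d^'d)"
    by (rule mat_pow_norm_bound[of A]) blast
  show ?thesis
  proof (rule summable_comparison_test')
    show "summable (\<lambda>n. ((K * t) ^ n / mlf_coeff \<alpha> n) * norm (mat 1 :: complex^'d^'d))"
      using K assms by (intro summable_mult2 summable_mlf_series) auto
    fix n
    have "norm (mlf_term \<alpha> (t *\<^sub>R A) n) = t ^ n / mlf_coeff \<alpha> n * norm (mat_pow A n)"
      using mlf_coeff_pos[OF assms(2), of n] assms by (simp add: mlf_term_def mat_pow_scaleR)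
    also have "\<dots> \<le> t ^ n / mlf_coeff \<alpha> n * (K ^ n * norm (mat 1 :: complex^'d^'d))"
      using mlf_coeff_pos[OF assms(2), of n] assms K by (intro mult_left_mono) auto
    finally show "norm (mlf_term \<alpha> (t *\<^sub>R A) n) \<le> ((K * t) ^ n / mlf_coeff \<alpha> n) * norm (mat 1 :: complex^'d^'d)"
      by (simp add: power_mult_distrib mult_ac)
  qed
qed

lemma mlf_solution_integral_equation:
  fixes A :: "complex^'d^'d" and \<theta> :: "real \<Rightarrow> complex^'d" and x0 :: "complex^'d"
  assumes \<alpha>: "0 < \<alpha>" "\<alpha> < 1" and \<theta>: "continuous_on {0..T} \<theta>"
    and x_def: "x = (\<lambda>t. mlf_mat \<alpha> (t *\<^sub>R A) *v x0
                       + (\<Sum>j. mat_pow A j *v LJ_iter (j + 1) \<alpha> \<theta> t))"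
  shows "t \<in> {0..T} \<Longrightarrow> summable (\<lambda>j. mat_pow A j *v LJ_iter (j + 1) \<alpha> \<theta> t)"
    and "continuous_on {0..T} x"
    and "t \<in> {0..T} \<Longrightarrow> x t = x0 + LJ \<alpha> (\<lambda>s. A *v x s + \<theta> s) t"
proof -
  obtain K where K: "K > 0" "\<And>n v. norm (mat_pow A n *v v) \<le> K ^ n * norm v"
    by (rule mat_pow_norm_bound[of A]) blast
  note pos = mlf_coeff_pos[OF \<alpha>(2)]
  have "bounded (\<theta> ` {0..T})"
    using \<theta> by (intro compact_imp_bounded compact_continuous_image) auto
  then obtain B where B0: "B > 0" and B: "\<And>s. s \<in> {0..T} \<Longrightarrow> norm (\<theta> s) \<le> B"
    unfolding bounded_pos by auto
  define Y1 where "Y1 n t = (t ^ n / mlf_coeff \<alpha> n) *\<^sub>R (mat_pow A n *v x0)" for n t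
  define Y2 where "Y2 n t = mat_pow A n *v LJ_iter (n + 1) \<alpha> \<theta> t" for n t
  define Y where "Y n t = Y1 n t + Y2 n t" for n t
  define M1 where "M1 n = (K * T) ^ n / mlf_coeff \<alpha> n * norm x0" for n
  \<comment> \<open>\<open>Y2 n\<close> carries only \<open>K ^ n\<close> but the iterate of order
    \<open>n + 1\<close>, whose bound has \<open>T ^ Suc n\<close> and
    \<open>mlf_coeff \<alpha> (Suc n)\<close>. Dividing by \<open>K\<close> restores the missing
    power, so this majorant is a shifted copy of the first.\<close>
  define M2 where "M2 n = (K * T) ^ Suc n / mlf_coeff \<alpha> (Suc n) * (B / K)" for n
  have Y1_le: "norm (Y1 n t) \<le> M1 n" if "t \<in> {0..T}" for n t
  proof -
    have "norm (Y1 n t) \<le> T ^ n / mlf_coeff \<alpha> n * (K ^ n * norm x0)"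
      unfolding Y1_def norm_scaleR using that pos[of n] K
      by (intro mult_mono) (auto intro!: divide_right_mono power_mono)
    then show ?thesis by (simp add: M1_def power_mult_distrib mult_ac)
  qed
  have Y2_le: "norm (Y2 n t) \<le> M2 n" if "t \<in> {0..T}" for n t
  proof -
    have "norm (Y2 n t) \<le> K ^ n * norm (LJ_iter (n + 1) \<alpha> \<theta> t)"
      unfolding Y2_def by (rule K)
    also have "\<dots> \<le> K ^ n * (B / mlf_coeff \<alpha> (Suc n) * t ^ Suc n)"
      using norm_LJ_iter_le[OF \<alpha> \<theta> B that, of "Suc n"] K by (intro mult_left_mono) auto
    also have "\<dots> \<le> K ^ n * (B / mlf_coeff \<alpha> (Suc n) * T ^ Suc n)"
      using pos[of "Suc n"] K B0 that by (intro mult_left_mono power_mono) auto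
    finally show ?thesis using K by (simp add: M2_def power_mult_distrib mult_ac)
  qed
  have sM: "summable M1" "summable M2" if "0 \<le> T"
  proof -
    have *: "summable (\<lambda>n. (K * T) ^ n / mlf_coeff \<alpha> n)"
      using \<alpha> K that by (intro summable_mlf_series) auto
    then show "summable M1" unfolding M1_def by (rule summable_mult2)
    from * have "summable (\<lambda>n. (K * T) ^ Suc n / mlf_coeff \<alpha> (Suc n))"
      by (subst summable_Suc_iff)
    then show "summable M2" unfolding M2_def by (rule summable_mult2)
  qed
  have sY1: "summable (\<lambda>n. Y1 n t)" and sY2: "summable (\<lambda>n. Y2 n t)" if "t \<in> {0..T}" for t
    using that Y1_le[OF that] Y2_le[OF that] sM
    by (auto intro: summable_comparison_test')
  show "summable (\<lambda>j. mat_pow A j *v LJ_iter (j + 1) \<alpha> \<theta> t)" if "t \<in> {0..T}"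
    using sY2[OF that] unfolding Y2_def .
  have xY: "x t = (\<Sum>n. Y n t)" if t: "t \<in> {0..T}" for t
  proof -
    have "mlf_mat \<alpha> (t *\<^sub>R A) *v x0 = (\<Sum>n. mlf_term \<alpha> (t *\<^sub>R A) n *v x0)"
      unfolding mlf_mat_def using t \<alpha>
      by (intro bounded_linear.suminf[OF bounded_linear_matrix_vector_mult_left] summable_mlf_term) auto
    also have "\<dots> = (\<Sum>n. Y1 n t)"
      by (simp add: Y1_def mlf_term_def mat_pow_scaleR scaleR_matrix_vector_mult)
    finally show ?thesis
      unfolding x_def Y_def using suminf_add[OF sY1[OF t] sY2[OF t]] by (simp add: Y2_def)
  qed
  define M where "M n = M1 n + M2 n" for n
  have Y_le: "norm (Y n t) \<le> M n" if "t \<in> {0..T}" for n t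
    unfolding Y_def M_def using Y1_le[OF that, of n] Y2_le[OF that, of n] by (rule norm_triangle_mono)
  have sM: "summable M" if "0 \<le> T"
    unfolding M_def using sM[OF that] by (rule summable_add)
  have contY: "continuous_on {0..T} (Y n)" for n
    unfolding Y_def Y1_def Y2_def
    by (intro continuous_intros continuous_on_LJ_iter \<alpha> \<theta>
        bounded_linear.continuous_on[OF matrix_vector_mul_bounded_linear]) (use pos[of n] in auto)
  show contx: "continuous_on {0..T} x"
  \<comment> \<open>The majorants are summable for \<open>0 \<le> T\<close>; otherwise the interval
    is empty.\<close>
  proof (cases "0 \<le> T")
    case True
    have "continuous_on {0..T} (\<lambda>t. \<Sum>n. Y n t)"
      using contY Y_le sM[OF True] by (rule continuous_on_suminf)
    then show ?thesis by (rule continuous_on_eq) (simp add: xY)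
  qed auto
  show "x t = x0 + LJ \<alpha> (\<lambda>s. A *v x s + \<theta> s) t" if t: "t \<in> {0..T}"
  proof -
    have sub: "{0..t} \<subseteq> {0..T}" and t0: "0 \<le> t" and T0: "0 \<le> T" using t by auto
    note blA = matrix_vector_mul_bounded_linear[of A]
    have contAY: "continuous_on {0..t} (\<lambda>s. A *v Y n s)" for n
      by (intro bounded_linear.continuous_on[OF blA] continuous_on_subset[OF contY sub])
    \<comment> \<open>The matrix \<open>A\<close> moves out of the integral and raises the matrix
      power, while \<open>LJ\<close> raises the power of \<open>t\<close> in one summand and the
      order of the iterate in the other.\<close>
    have shift: "LJ \<alpha> (\<lambda>s. A *v Y n s) t = Y (Suc n) t" for n
    proof -
      have "LJ \<alpha> (\<lambda>s. A *v Y n s) t = A *v LJ \<alpha> (Y n) t"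
        by (intro LJ_bounded_linear \<alpha> t0 continuous_on_subset[OF contY sub] blA)
      also have "LJ \<alpha> (Y n) t = LJ \<alpha> (\<lambda>s. s ^ n *\<^sub>R ((1 / mlf_coeff \<alpha> n) *\<^sub>R (mat_pow A n *v x0)) + mat_pow A n *v LJ_iter (n + 1) \<alpha> \<theta> s) t"
        by (intro LJ_cong) (simp add: Y_def Y1_def Y2_def)
      also have "\<dots> = LJ \<alpha> (\<lambda>s. s ^ n *\<^sub>R ((1 / mlf_coeff \<alpha> n) *\<^sub>R (mat_pow A n *v x0))) t + LJ \<alpha> (\<lambda>s. mat_pow A n *v LJ_iter (n + 1) \<alpha> \<theta> s) t"
        by (intro LJ_add \<alpha> t0 continuous_intros bounded_linear.continuous_on[OF matrix_vector_mul_bounded_linear]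
            continuous_on_subset[OF continuous_on_LJ_iter[OF \<alpha> \<theta>] sub])
      also have "LJ \<alpha> (\<lambda>s. mat_pow A n *v LJ_iter (n + 1) \<alpha> \<theta> s) t = mat_pow A n *v LJ_iter (Suc (n + 1)) \<alpha> \<theta> t"
        unfolding LJ_iter_Suc[of "n + 1"]
        by (intro LJ_bounded_linear \<alpha> t0 matrix_vector_mul_bounded_linear
            continuous_on_subset[OF continuous_on_LJ_iter[OF \<alpha> \<theta>] sub])
      also have "LJ \<alpha> (\<lambda>s. s ^ n *\<^sub>R ((1 / mlf_coeff \<alpha> n) *\<^sub>R (mat_pow A n *v x0))) t
          = (t ^ Suc n / mlf_coeff \<alpha> (Suc n)) *\<^sub>R (mat_pow A n *v x0)"
        using pos[of n] by (subst LJ_power[OF \<alpha> t0]) simp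
      also have "A *v ((t ^ Suc n / mlf_coeff \<alpha> (Suc n)) *\<^sub>R (mat_pow A n *v x0) + mat_pow A n *v LJ_iter (Suc (n + 1)) \<alpha> \<theta> t) = Y (Suc n) t"
        by (simp add: Y_def Y1_def Y2_def mat_pow_Suc matrix_vector_mul_assoc[symmetric]
            matrix_vector_right_distrib scaleR_matrix_vector_mult)
      finally show ?thesis .
    qed
    obtain KA where KA: "KA > 0" "\<And>v. norm (A *v v) \<le> norm v * KA"
      using bounded_linear.pos_bounded[OF blA] by blast
    have "(\<lambda>n. LJ \<alpha> (\<lambda>s. A *v Y n s) t) sums LJ \<alpha> (\<lambda>s. \<Sum>n. A *v Y n s) t"
    proof (rule LJ_suminf[OF \<alpha> t0 contAY])
      show "summable (\<lambda>n. M n * KA)" using sM[OF T0] by (rule summable_mult2)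
      fix n s assume "s \<in> {0..t}"
      then have "norm (Y n s) \<le> M n" using sub by (intro Y_le) auto
      then show "norm (A *v Y n s) \<le> M n * KA"
        using KA(2)[of "Y n s"] KA(1) mult_right_mono[of "norm (Y n s)" "M n" KA] by linarith
    qed
    moreover have "LJ \<alpha> (\<lambda>s. \<Sum>n. A *v Y n s) t = LJ \<alpha> (\<lambda>s. A *v x s) t"
    proof (rule LJ_cong)
      fix s assume "s \<in> {0..t}"
      then have s: "s \<in> {0..T}" using sub by auto
      have "summable (\<lambda>n. Y n s)" using summable_add[OF sY1[OF s] sY2[OF s]] by (simp add: Y_def)
      then show "(\<Sum>n. A *v Y n s) = A *v x s"
        unfolding xY[OF s] by (intro bounded_linear.suminf[OF blA, symmetric])
    qed
    ultimately have "(\<Sum>n. Y (Suc n) t) = LJ \<alpha> (\<lambda>s. A *v x s) t"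
      by (simp add: shift sums_iff)
    moreover have "summable (\<lambda>n. Y n t)" using summable_add[OF sY1[OF t] sY2[OF t]] by (simp add: Y_def)
    then have "x t = (\<Sum>n. Y (Suc n) t) + Y 0 t"
      unfolding xY[OF t] using suminf_split_head[of "\<lambda>n. Y n t"] by simp
    \<comment> \<open>The shifted series lacks exactly this zeroth term, which supplies the initial
      value and the forcing term of the equation.\<close>
    moreover have "Y 0 t = x0 + LJ \<alpha> \<theta> t"
      by (simp add: Y_def Y1_def Y2_def LJ_iter_def)
    moreover have "LJ \<alpha> (\<lambda>s. A *v x s + \<theta> s) t = LJ \<alpha> (\<lambda>s. A *v x s) t + LJ \<alpha> \<theta> t"
      by (intro LJ_add \<alpha> t0 bounded_linear.continuous_on[OF blA] continuous_on_subset[OF contx sub]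
          continuous_on_subset[OF \<theta> sub])
    ultimately show ?thesis by simp
  qed
qed

lemma LJ_power_series:
  fixes y :: "real \<Rightarrow> 'a::euclidean_space"
  assumes \<alpha>: "0 < \<alpha>" "\<alpha> < 1" and t: "t \<in> {0..T}"
    and c: "summable (\<lambda>n. norm (c n) * T ^ n)" and y: "\<And>s. s \<in> {0..T} \<Longrightarrow> y s = (\<Sum>n. s ^ n *\<^sub>R c n)"
  shows "(\<lambda>n. (mlf_coeff \<alpha> n / mlf_coeff \<alpha> (Suc n) * t ^ Suc n) *\<^sub>R c n) sums LJ \<alpha> y t"
proof -
  have "(\<lambda>n. LJ \<alpha> (\<lambda>s. s ^ n *\<^sub>R c n) t) sums LJ \<alpha> (\<lambda>s. \<Sum>n. s ^ n *\<^sub>R c n) t"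
  proof (rule LJ_suminf[OF \<alpha> _ _ _ c])
    show "norm (s ^ n *\<^sub>R c n) \<le> norm (c n) * T ^ n" if "s \<in> {0..t}" for n s
      using that t by (auto simp: mult.commute[of "norm (c n)"] intro!: mult_right_mono power_mono)
  qed (use t in \<open>auto intro!: continuous_intros\<close>)
  moreover have "LJ \<alpha> (\<lambda>s. \<Sum>n. s ^ n *\<^sub>R c n) t = LJ \<alpha> y t"
    using t by (intro LJ_cong) (auto simp: y)
  ultimately show ?thesis
    using t by (simp add: LJ_power[OF \<alpha>])
qed

section \<open>Riemann-Liouville integrals\<close>

text \<open>Nonnegativity upgrades gauge integrability to absolute integrability, and Borel
  measurability then descends from the completion to \<open>lborel\<close>. This carries the Beta
  integrals to the measure on which Fubini is applied.\<close>

lemma set_integrable_lborel_nonneg: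
  fixes f :: "'b::euclidean_space \<Rightarrow> real"
  assumes "f \<in> borel_measurable borel" "S \<in> sets borel" "\<And>x. x \<in> S \<Longrightarrow> 0 \<le> f x" "(f has_integral I) S"
  shows "set_integrable lborel S f" "(LINT x:S|lborel. f x) = I"
proof -
  have "f absolutely_integrable_on S"
    using assms by (intro nonnegative_absolutely_integrable_1) (auto simp: has_integral_iff)
  then show int: "set_integrable lborel S f"
    using assms(1,2) unfolding set_integrable_def by (subst (asm) integrable_completion) auto
  show "(LINT x:S|lborel. f x) = I"
    using set_borel_integral_eq_integral(2)[OF int] assms(4) by (simp add: integral_unique)
qed

text \<open>Riemann-Liouville integral without the factor \<open>1 / Gamma p\<close>. The Bochner integral has junk
  value 0 where the kernel is not integrable, so values are meaningful only almost everywhere.\<close>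
definition rl_integral :: "real \<Rightarrow> (real \<Rightarrow> 'a::euclidean_space) \<Rightarrow> real \<Rightarrow> 'a" where
  "rl_integral p h t = (LINT s:{0..t}|lborel. (t - s) powr (p - 1) *\<^sub>R h s)"

lemma rl_integral_cong: "(\<And>s. s \<in> {0..t} \<Longrightarrow> h s = k s) \<Longrightarrow> rl_integral p h t = rl_integral p k t"
  unfolding rl_integral_def by (intro set_lebesgue_integral_cong) auto

lemma rl_integral_scaleR: "rl_integral p (\<lambda>s. c *\<^sub>R h s) t = c *\<^sub>R rl_integral p h t"
  unfolding rl_integral_def
  by (simp only: scaleR_left_commute[of _ c] set_integral_scaleR_right)

text \<open>The kernel \<open>(t - s) powr 0\<close> is 1 except at \<open>s = t\<close>, where it is 0.\<close>
lemma rl_integral_1: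
  fixes h :: "real \<Rightarrow> 'a::euclidean_space"
  assumes "set_integrable lborel {0..t} (\<lambda>s. (t - s) powr (1 - 1) *\<^sub>R h s)"
  shows "h integrable_on {0..t}" "rl_integral 1 h t = integral {0..t} h"
proof -
  have "((\<lambda>s. (t - s) powr (1 - 1) *\<^sub>R h s) has_integral rl_integral 1 h t) {0..t}"
    using set_borel_integral_eq_integral[OF assms] by (simp add: rl_integral_def has_integral_iff)
  then have "(h has_integral rl_integral 1 h t) {0..t}"
    by (rule has_integral_spike[of "{t}", rotated 2]) auto
  then show "h integrable_on {0..t}" "rl_integral 1 h t = integral {0..t} h"
    by (auto simp: has_integral_iff)
qed

lemma set_integrable_powr_0:
  fixes h :: "real \<Rightarrow> 'a::euclidean_space"
  assumes "integrable lborel h"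
  shows "set_integrable lborel {0..t} (\<lambda>s. (t - s) powr (1 - 1) *\<^sub>R h s)"
  unfolding set_integrable_def
proof (rule Bochner_Integration.integrable_bound[OF assms])
  have [measurable]: "h \<in> borel_measurable borel" using assms by auto
  show "(\<lambda>s. indicat_real {0..t} s *\<^sub>R (t - s) powr (1 - 1) *\<^sub>R h s) \<in> borel_measurable lborel"
    by measurable
qed (auto simp: indicator_def)

text \<open>All three claims come from Fubini for a single function \<open>f\<close> on the triangle
  \<open>0 \<le> r \<le> s \<le> t\<close>. Integrating over \<open>s\<close> first yields the Beta
  kernel, a multiple of \<open>(t - r) powr (p + q - 1)\<close>, bounded because
  \<open>p + q \<ge> 1\<close>, so integrability of \<open>h\<close> suffices. Integrating over
  \<open>r\<close> first yields \<open>rl_integral q h\<close>.\<close>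

lemma
  fixes h :: "real \<Rightarrow> 'a::euclidean_space"
  assumes p: "p > 0" and q: "q > 0" and pq: "p + q \<ge> 1" and t: "0 \<le> t" and h: "integrable lborel h"
  shows rl_integral_integrable: "set_integrable lborel {0..t} (\<lambda>s. (t - s) powr (p - 1) *\<^sub>R rl_integral q h s)"
    and rl_integral_semigroup: "rl_integral p (rl_integral q h) t = Beta q p *\<^sub>R rl_integral (p + q) h t"
    and AE_rl_kernel_integrable: "AE s in lborel. s \<in> {0..t} \<longrightarrow> set_integrable lborel {0..s} (\<lambda>r. (s - r) powr (q - 1) *\<^sub>R h r)"
proof -
  have [measurable]: "h \<in> borel_measurable borel" using h by auto
  define f where "f r s = (if 0 \<le> r \<and> r \<le> s \<and> s \<le> t then ((t - s) powr (p - 1) * (s - r) powr (q - 1)) *\<^sub>R h r else 0)" for r s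
  define k where "k r = (if r \<in> {0..t} then (t - r) powr (q + p - 1) * Beta q p else 0)" for r
  define c where "c = t powr (q + p - 1) * Beta q p"
  have Bpos: "Beta q p \<ge> 0" using p q unfolding Beta_def by (auto intro!: divide_nonneg_pos mult_nonneg_nonneg less_imp_le[OF Gamma_real_pos] Gamma_real_pos)
  have kb: "0 \<le> k r" "k r \<le> c" for r
    using Bpos pq by (auto simp: k_def c_def intro!: mult_right_mono powr_mono2)
  have inner: "integrable lborel (\<lambda>s. if 0 \<le> r \<and> r \<le> s \<and> s \<le> t then (t - s) powr (p - 1) * (s - r) powr (q - 1) else 0)"
      "(LINT s|lborel. (if 0 \<le> r \<and> r \<le> s \<and> s \<le> t then (t - s) powr (p - 1) * (s - r) powr (q - 1) else 0)) = k r" for r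
  proof -
    have "set_integrable lborel {r..t} (\<lambda>s. (s - r) powr (q - 1) * (t - s) powr (p - 1)) \<and>
      (LINT s:{r..t}|lborel. (s - r) powr (q - 1) * (t - s) powr (p - 1)) = k r" if "r \<in> {0..t}"
      using set_integrable_lborel_nonneg[OF _ _ _ has_integral_Beta_kernel[OF q p, of r t]] that
      by (auto simp: k_def)
    moreover have "(if 0 \<le> r \<and> r \<le> s \<and> s \<le> t then (t - s) powr (p - 1) * (s - r) powr (q - 1) else 0)
      = (if r \<in> {0..t} then indicator {r..t} s *\<^sub>R ((s - r) powr (q - 1) * (t - s) powr (p - 1)) else 0)" for s
      by (auto simp: indicator_def)
    ultimately show "integrable lborel (\<lambda>s. if 0 \<le> r \<and> r \<le> s \<and> s \<le> t then (t - s) powr (p - 1) * (s - r) powr (q - 1) else 0)"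
      "(LINT s|lborel. (if 0 \<le> r \<and> r \<le> s \<and> s \<le> t then (t - s) powr (p - 1) * (s - r) powr (q - 1) else 0)) = k r"
      unfolding set_integrable_def set_lebesgue_integral_def
      by (cases "r \<in> {0..t}"; force simp: k_def)+
  qed
  have fs: "f r s = (if 0 \<le> r \<and> r \<le> s \<and> s \<le> t then (t - s) powr (p - 1) * (s - r) powr (q - 1) else 0) *\<^sub>R h r" for r s
    by (simp add: f_def)
  have int_f: "integrable (lborel \<Otimes>\<^sub>M lborel) (case_prod f)"
  proof (rule lborel_pair.Fubini_integrable)
    show "case_prod f \<in> borel_measurable (lborel \<Otimes>\<^sub>M lborel)"
      unfolding f_def by measurable
    have "norm (f r s) = (if 0 \<le> r \<and> r \<le> s \<and> s \<le> t then (t - s) powr (p - 1) * (s - r) powr (q - 1) else 0) * norm (h r)" for r s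
      by (simp add: f_def)
    then have "(LINT s|lborel. norm (f r s)) = k r * norm (h r)" for r
      using inner by simp
    moreover have "integrable lborel (\<lambda>r. k r * norm (h r))"
    proof (rule Bochner_Integration.integrable_bound)
      show "integrable lborel (\<lambda>r. c * norm (h r))" using h by simp
      show "(\<lambda>r. k r * norm (h r)) \<in> borel_measurable lborel" unfolding k_def by measurable
      show "AE r in lborel. norm (k r * norm (h r)) \<le> norm (c * norm (h r))"
        using kb order_trans[OF kb] by (intro AE_I2) (auto simp: abs_mult intro!: mult_right_mono)
    qed
    ultimately show "integrable lborel (\<lambda>r. LINT s|lborel. norm (case (r, s) of (r, s) \<Rightarrow> f r s))"
      by simp
    show "AE r in lborel. integrable lborel (\<lambda>s. case (r, s) of (r, s) \<Rightarrow> f r s)"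
      unfolding fs using inner(1) by (intro AE_I2) simp
  qed
  have f_ind: "f r s = indicator {0..t} s *\<^sub>R ((t - s) powr (p - 1) *\<^sub>R (indicator {0..s} r *\<^sub>R ((s - r) powr (q - 1) *\<^sub>R h r)))" for r s
    by (auto simp: f_def indicator_def)
  have inner_r: "(LINT r|lborel. f r s) = indicator {0..t} s *\<^sub>R ((t - s) powr (p - 1) *\<^sub>R rl_integral q h s)" for s
    unfolding f_ind rl_integral_def set_lebesgue_integral_def by (simp only: integral_scaleR_right)
  show "set_integrable lborel {0..t} (\<lambda>s. (t - s) powr (p - 1) *\<^sub>R rl_integral q h s)"
    using lborel_pair.integrable_snd[OF int_f] unfolding inner_r set_integrable_def .
  have "rl_integral p (rl_integral q h) t = (LINT s|lborel. (LINT r|lborel. f r s))"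
    unfolding inner_r rl_integral_def[of p] set_lebesgue_integral_def ..
  also have "\<dots> = (LINT r|lborel. (LINT s|lborel. f r s))"
    by (rule lborel_pair.Fubini_integral[OF int_f])
  also have "\<dots> = (LINT r|lborel. k r *\<^sub>R h r)"
    unfolding fs using inner by simp
  also have "\<dots> = (LINT r|lborel. Beta q p *\<^sub>R (indicator {0..t} r *\<^sub>R ((t - r) powr (p + q - 1) *\<^sub>R h r)))"
    by (intro Bochner_Integration.integral_cong) (auto simp: k_def indicator_def add.commute)
  also have "\<dots> = Beta q p *\<^sub>R rl_integral (p + q) h t"
    unfolding rl_integral_def set_lebesgue_integral_def by (simp only: integral_scaleR_right)
  finally show "rl_integral p (rl_integral q h) t = Beta q p *\<^sub>R rl_integral (p + q) h t" .
  have "AE s in lborel. integrable lborel (\<lambda>r. f r s)"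
    using lborel_pair.AE_integrable_snd[OF int_f] by simp
  \<comment> \<open>At \<open>s = t\<close> the outer factor \<open>(t - s) powr (p - 1)\<close> is
    0; elsewhere it can be divided out to isolate the inner kernel.\<close>
  moreover have "AE s in lborel. s \<noteq> t" by (rule AE_lborel_singleton)
  ultimately show "AE s in lborel. s \<in> {0..t} \<longrightarrow> set_integrable lborel {0..s} (\<lambda>r. (s - r) powr (q - 1) *\<^sub>R h r)"
  proof eventually_elim
    case (elim s)
    show ?case
    proof
      assume "s \<in> {0..t}"
      then have "inverse ((t - s) powr (p - 1)) *\<^sub>R f r s = indicator {0..s} r *\<^sub>R ((s - r) powr (q - 1) *\<^sub>R h r)" for r
        using elim(2) by (simp add: f_ind)
      then show "set_integrable lborel {0..s} (\<lambda>r. (s - r) powr (q - 1) *\<^sub>R h r)"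
        using integrable_scaleR_right[OF elim(1), of "inverse ((t - s) powr (p - 1))"]
        by (simp only: set_integrable_def)
    qed
  qed
qed

text \<open>The density in \<open>abs_cont_on\<close> is only Lebesgue measurable, while the
  semigroup law is stated for \<open>lborel\<close>. Each coordinate agrees almost everywhere with a
  Borel function, and there are finitely many coordinates.\<close>

lemma integrable_lebesgue_borel_representative:
  fixes g :: "'b::euclidean_space \<Rightarrow> 'a::euclidean_space"
  assumes g: "integrable lebesgue g"
  obtains g' where "integrable lborel g'" "AE x in lborel. g x = g' x"
proof -
  have "\<exists>k\<in>borel_measurable lborel. AE x in lborel. g x \<bullet> b = k x" for b
    using g by (intro completion_ex_borel_measurable_real) auto
  then obtain k where k: "\<And>b. k b \<in> borel_measurable lborel" "\<And>b. AE x in lborel. g x \<bullet> b = k b x"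
    by metis
  define g' where "g' x = (\<Sum>b\<in>Basis. k b x *\<^sub>R b)" for x
  have m: "g' \<in> borel_measurable lborel" 
    unfolding g'_def by (intro borel_measurable_sum borel_measurable_scaleR k(1) borel_measurable_const)
  have "AE x in lborel. \<forall>b\<in>Basis. g x \<bullet> b = k b x"
    using k(2) by (intro AE_finite_allI) auto
  then have ae: "AE x in lborel. g x = g' x"
  proof eventually_elim
    case (elim x)
    then have "(\<Sum>b\<in>Basis. (g x \<bullet> b) *\<^sub>R b) = g' x" unfolding g'_def by (intro sum.cong) auto
    then show ?case by (simp add: euclidean_representation)
  qed
  have "integrable lebesgue g'"
    by (rule integrable_cong_AE_imp[OF g measurable_completion[OF m] AE_completion[OF ae]])
  with m have "integrable lborel g'" by (simp add: integrable_completion)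
  with ae that show ?thesis by blast
qed

text \<open>Almost everywhere \<open>w t\<close> is the derivative of its indefinite integral, here
  the zero function. Uniqueness of derivatives within the interval relies on
  \<open>a < b\<close>.\<close>

lemma AE_zero_if_indefinite_integral_zero:
  fixes w :: "real \<Rightarrow> 'a::euclidean_space"
  assumes "a < b" "w integrable_on {a..b}" "\<And>t. t \<in> {a..b} \<Longrightarrow> integral {a..t} w = 0"
  shows "AE t in lborel. t \<in> {a..b} \<longrightarrow> w t = 0"
proof -
  have "AE t in lebesgue. t \<notin> {x \<in> {a..b}. \<not> ((\<lambda>t. integral {a..t} w) has_vector_derivative w x) (at x within {a..b})}"
    using negligible_not_differentiable_indefinite_integral[OF assms(2)]
    by (intro AE_not_in) (simp add: negligible_iff_null_sets)
  then have "AE t in lborel. t \<notin> {x \<in> {a..b}. \<not> ((\<lambda>t. integral {a..t} w) has_vector_derivative w x) (at x within {a..b})}"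
    by (simp add: AE_completion_iff)
  then show ?thesis
  proof eventually_elim
    case (elim t)
    show ?case
    proof
      assume t: "t \<in> {a..b}"
      with elim have "((\<lambda>t. integral {a..t} w) has_vector_derivative w t) (at t within {a..b})" by auto
      then have "((\<lambda>t. 0) has_vector_derivative w t) (at t within {a..b})"
        by (rule has_vector_derivative_transform[OF t, rotated]) (simp add: assms(3))
      then show "w t = 0"
        using vector_derivative_unique_within_closed_interval[OF assms(1), of t "\<lambda>_. 0" "w t" 0] t
        by auto
    qed
  qed
qed

section \<open>The L-fractional derivative\<close>

lemma LD_eq_AE:
  fixes x y :: "real \<Rightarrow> 'a::euclidean_space"
  assumes \<alpha>: "0 < \<alpha>" "\<alpha> < 1" and T: "0 < T" and y: "continuous_on {0..T} y"
    and x: "\<And>t. t \<in> {0..T} \<Longrightarrow> x t = x0 + LJ \<alpha> y t"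
    and ac: "abs_cont_on T x"
  shows "AE t in lborel. t \<in> {0..T} \<longrightarrow> LD T \<alpha> x t = y t"
proof -
  obtain g where g: "g absolutely_integrable_on {0..T}" "\<And>t. t \<in> {0..T} \<Longrightarrow> x t = x 0 + integral {0..t} g"
    using ac unfolding abs_cont_on_def by blast
  obtain G where G: "integrable lborel G" "AE s in lborel. indicator {0..T} s *\<^sub>R g s = G s"
    by (rule integrable_lebesgue_borel_representative[OF g(1)[unfolded set_integrable_def]])
  \<comment> \<open>\<open>H / Gamma (2 - \<alpha>)\<close> is the Caputo derivative that the
    equation prescribes, cut off to \<open>{0..T}\<close> so as to be integrable on the whole
    line.\<close>
  define H where "H s = indicator {0..T} s *\<^sub>R (s powr (1 - \<alpha>) *\<^sub>R y s)" for s
  have "continuous_on {0..T} (\<lambda>s. s powr (1 - \<alpha>) *\<^sub>R y s)"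
    using \<alpha> y by (intro continuous_intros continuous_on_powr') auto
  then have H: "integrable lborel H"
    unfolding H_def set_integrable_def[symmetric] by (rule borel_integrable_atLeastAtMost')
  define C where "C = Gamma \<alpha> * Gamma (2 - \<alpha>)"
  have Gpos: "Gamma \<alpha> > 0" "Gamma (2 - \<alpha>) > 0" "Gamma (1 - \<alpha>) > 0"
    using \<alpha> by (auto intro!: Gamma_real_pos)
  have "AE s in lebesgue. indicator {0..T} s *\<^sub>R g s = G s" using G(2) by (rule AE_completion)
  then obtain N where N0: "N \<in> null_sets lebesgue" "{s. indicator {0..T} s *\<^sub>R g s \<noteq> G s} \<subseteq> N"
    by (auto simp: eventually_ae_filter)
  have N1: "negligible N" using N0(1) by (simp add: negligible_iff_null_sets)
  have N2: "g s = G s" if "s \<in> {0..T}" "s \<notin> N" for s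
  proof -
    have "indicator {0..T} s *\<^sub>R g s = G s" using N0(2) that(2) by blast
    then show "g s = G s" using that(1) by simp
  qed
  have x_rl: "rl_integral 1 G t = (1 / C) *\<^sub>R rl_integral \<alpha> H t" if t: "t \<in> {0..T}" for t
  proof -
    have "LJ \<alpha> y 0 = 0" by (simp add: LJ_def)
    then have "integral {0..t} g = LJ \<alpha> y t"
      using g(2)[OF t] x[OF t] x[of 0] T by simp
    moreover have "integral {0..t} g = integral {0..t} G"
      using N2 t by (intro integral_spike[OF N1]) auto
    moreover have "LJ \<alpha> y t = (1 / C) *\<^sub>R rl_integral \<alpha> H t"
    proof -
      have eq: "((t - s) powr (\<alpha> - 1) * s powr (1 - \<alpha>)) *\<^sub>R y s = (t - s) powr (\<alpha> - 1) *\<^sub>R H s" if "s \<in> {0..t}" for s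
        using that t by (auto simp: H_def)
      \<comment> \<open>Absolute integrability together with Borel measurability excludes the
        default value 0 of the Bochner integral, so the identity with \<open>LJ\<close> holds for
        every \<open>t\<close> and not merely almost everywhere.\<close>
      have "(\<lambda>s. ((t - s) powr (\<alpha> - 1) * s powr (1 - \<alpha>)) *\<^sub>R y s) absolutely_integrable_on {0..t}"
        using t by (intro LJ_kernel_absolutely_integrable \<alpha> continuous_on_subset[OF y]) auto
      then have "set_integrable lebesgue {0..t} (\<lambda>s. (t - s) powr (\<alpha> - 1) *\<^sub>R H s)"
        by (subst (asm) set_integrable_cong[OF refl refl eq]) auto
      moreover have "(\<lambda>s. indicator {0..t} s *\<^sub>R ((t - s) powr (\<alpha> - 1) *\<^sub>R H s)) \<in> borel_measurable lborel"
        using borel_measurable_integrable[OF H] by measurable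
      ultimately have "set_integrable lborel {0..t} (\<lambda>s. (t - s) powr (\<alpha> - 1) *\<^sub>R H s)"
        unfolding set_integrable_def by (simp add: integrable_completion)
      then have "rl_integral \<alpha> H t = integral {0..t} (\<lambda>s. (t - s) powr (\<alpha> - 1) *\<^sub>R H s)"
        unfolding rl_integral_def by (rule set_borel_integral_eq_integral(2))
      also have "\<dots> = integral {0..t} (\<lambda>s. ((t - s) powr (\<alpha> - 1) * s powr (1 - \<alpha>)) *\<^sub>R y s)"
        by (intro Henstock_Kurzweil_Integration.integral_cong) (simp add: eq)
      finally show ?thesis by (simp add: LJ_def C_def)
    qed
    ultimately show ?thesis
      using rl_integral_1(2)[OF set_integrable_powr_0[OF G(1)], of t] by simp
  qed
  \<comment> \<open>Up to the factor \<open>1 / Gamma (1 - \<alpha>)\<close> this is the Caputo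
    derivative of \<open>x\<close>, with the Borel representative \<open>G\<close> in place of the
    derivative.\<close>
  define W where "W s = rl_integral (1 - \<alpha>) G s" for s
  have W_int: "set_integrable lborel {0..t} (\<lambda>s. (t - s) powr (1 - 1) *\<^sub>R W s)" if "0 \<le> t" for t
    unfolding W_def using \<alpha> that G(1) by (intro rl_integral_integrable) auto
  \<comment> \<open>The integrals are unnormalised, so Beta factors accumulate; \<open>c\<close>
    equals \<open>Beta \<alpha> (1 - \<alpha>) / C\<close>.\<close>
  define c where "c = Gamma (1 - \<alpha>) / Gamma (2 - \<alpha>)"
  have "rl_integral 1 W t = c *\<^sub>R rl_integral 1 H t" if t: "t \<in> {0..T}" for t
  proof -
    have t0: "0 \<le> t" using t by auto
    \<comment> \<open>Through order \<open>2 - \<alpha>\<close> the integrals of orders 1 and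
      \<open>1 - \<alpha>\<close> are interchanged, the two Beta factors agreeing by symmetry. This
      brings \<open>rl_integral 1 G\<close> inside, where \<open>x_rl\<close> rewrites it.\<close>
    have "rl_integral 1 W t = Beta (1 - \<alpha>) 1 *\<^sub>R rl_integral (2 - \<alpha>) G t"
      unfolding W_def using \<alpha> t0 G(1) by (subst rl_integral_semigroup) auto
    also have "\<dots> = rl_integral (1 - \<alpha>) (rl_integral 1 G) t"
      using \<alpha> t0 G(1) by (subst rl_integral_semigroup) (auto simp: Beta_commute)
    also have "\<dots> = rl_integral (1 - \<alpha>) (\<lambda>s. (1 / C) *\<^sub>R rl_integral \<alpha> H s) t"
      using t by (intro rl_integral_cong x_rl) auto
    also have "\<dots> = (1 / C * Beta \<alpha> (1 - \<alpha>)) *\<^sub>R rl_integral 1 H t"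
      unfolding rl_integral_scaleR using \<alpha> t0 H by (subst rl_integral_semigroup) auto
    also have "1 / C * Beta \<alpha> (1 - \<alpha>) = c"
      using Gpos by (simp add: C_def c_def Beta_def)
    finally show ?thesis .
  qed
  then have eqI: "integral {0..t} W = c *\<^sub>R integral {0..t} H" if "t \<in> {0..T}" for t
    using that rl_integral_1(2)[OF W_int, of t] rl_integral_1(2)[OF set_integrable_powr_0[OF H], of t] by simp
  have Wi: "W integrable_on {0..t}" "H integrable_on {0..t}" if "0 \<le> t" for t
    using rl_integral_1(1)[OF W_int[OF that]] rl_integral_1(1)[OF set_integrable_powr_0[OF H], of t] by simp_all
  have "AE t in lborel. t \<in> {0..T} \<longrightarrow> W t - c *\<^sub>R H t = 0"
  proof (rule AE_zero_if_indefinite_integral_zero[OF T])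
    show "(\<lambda>t. W t - c *\<^sub>R H t) integrable_on {0..T}"
      using T by (intro integrable_diff integrable_cmul Wi) auto
    fix t assume t: "t \<in> {0..T}"
    have "integral {0..t} (\<lambda>t. W t - c *\<^sub>R H t) = integral {0..t} W - c *\<^sub>R integral {0..t} H"
      using t Wi[of t] by (subst Henstock_Kurzweil_Integration.integral_diff) (auto intro: integrable_cmul)
    then show "integral {0..t} (\<lambda>t. W t - c *\<^sub>R H t) = 0" using eqI[OF t] by simp
  qed
  \<comment> \<open>Where the kernel is not integrable, \<open>W\<close> has the default value 0 and
    need not be the gauge integral in \<open>caputo\<close>; such points are discarded. So is
    \<open>t = 0\<close>, where \<open>LD\<close> is given by a separate clause.\<close>
  moreover have "AE s in lborel. s \<in> {0..T} \<longrightarrow> set_integrable lborel {0..s} (\<lambda>r. (s - r) powr ((1 - \<alpha>) - 1) *\<^sub>R G r)"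
    using \<alpha> T G(1) by (intro AE_rl_kernel_integrable[of 1]) auto
  moreover have "AE t in lborel. t \<noteq> (0::real)" by (rule AE_lborel_singleton)
  ultimately show ?thesis
  proof eventually_elim
    case (elim t)
    show ?case
    proof
      assume t: "t \<in> {0..T}"
      have gi: "g integrable_on {0..T}" using g(1) set_lebesgue_integral_eq_integral(1) by blast
      \<comment> \<open>Off this set the density \<open>g\<close> is both the derivative of
        \<open>x\<close> and equal to \<open>G\<close>, so the Caputo integrand may be replaced for
        every \<open>t\<close> at once.\<close>
      define N' where "N' = N \<union> {x \<in> {0..T}. \<not> ((\<lambda>t. integral {0..t} g) has_vector_derivative g x) (at x within {0..T})}"
      have N': "negligible N'"
        unfolding N'_def using N1 negligible_not_differentiable_indefinite_integral[OF gi] by simp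
      have deriv: "vector_derivative x (at s within {0..T}) = G s" if "s \<in> {0..T} - N'" for s
      proof -
        have s: "s \<in> {0..T}" "s \<notin> N" using that by (auto simp: N'_def)
        have "((\<lambda>t. integral {0..t} g) has_vector_derivative g s) (at s within {0..T})"
          using that by (auto simp: N'_def)
        then have "((\<lambda>t. x 0 + integral {0..t} g) has_vector_derivative g s) (at s within {0..T})"
          by (auto intro!: derivative_eq_intros)
        then have "(x has_vector_derivative g s) (at s within {0..T})"
          by (rule has_vector_derivative_transform[OF s(1), rotated]) (rule g(2))
        then have "vector_derivative x (at s within {0..T}) = g s"
          using vector_derivative_within_cbox[OF T, of s x "g s"] s by simp
        then show ?thesis using N2[OF s] by simp
      qed
      have "integral {0..t} (\<lambda>\<tau>. (t - \<tau>) powr (- \<alpha>) *\<^sub>R vector_derivative x (at \<tau> within {0..T}))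
          = integral {0..t} (\<lambda>\<tau>. (t - \<tau>) powr (- \<alpha>) *\<^sub>R G \<tau>)"
        using deriv t by (intro integral_spike[OF N']) auto
      also have "\<dots> = W t"
        using set_borel_integral_eq_integral(2)[of "{0..t}" "\<lambda>r. (t - r) powr ((1 - \<alpha>) - 1) *\<^sub>R G r"] elim t
        by (simp add: W_def rl_integral_def)
      also have "\<dots> = (c * t powr (1 - \<alpha>)) *\<^sub>R y t"
        using elim t by (simp add: H_def)
      finally have "caputo T \<alpha> x t = (t powr (1 - \<alpha>) / Gamma (2 - \<alpha>)) *\<^sub>R y t"
        unfolding caputo_def using Gpos by (simp add: c_def)
      then show "LD T \<alpha> x t = y t"
        using elim Gpos by (simp add: LD_def)
    qed
  qed
qed

section \<open>Power series and the equation at every point\<close>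

lemma summable_Suc_mult_power:
  fixes a :: "nat \<Rightarrow> real"
  assumes "summable (\<lambda>n. a n * T ^ n)" "0 \<le> r" "r < T"
  shows "summable (\<lambda>n. real (Suc n) * a n * r ^ n)"
proof -
  \<comment> \<open>These are the coefficients of \<open>\<Sum> a n * z ^ Suc n\<close>; their
    formal derivative \<open>diffs c\<close> has the coefficients
    \<open>Suc n * a n\<close>.\<close>
  define c where "c n = (case n of 0 \<Rightarrow> 0 | Suc m \<Rightarrow> a m)" for n
  have "summable (\<lambda>n. diffs c n * r ^ n)"
  proof (rule termdiff_converges)
    show "norm r < T" using assms by simp
    fix z :: real assume "norm z < T"
    then have "summable (\<lambda>n. a n * z ^ n)"
      using assms by (intro powser_inside[OF assms(1)]) auto
    then have "summable (\<lambda>n. a n * z ^ n * z)" by (rule summable_mult2)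
    then have "summable (\<lambda>n. c (Suc n) * z ^ Suc n)" by (simp add: c_def mult_ac)
    then show "summable (\<lambda>n. c n * z ^ n)" by (subst (asm) summable_Suc_iff)
  qed
  then show ?thesis by (simp add: diffs_def c_def)
qed

text \<open>For \<open>\<tau> < r < T\<close> the differentiated series converges uniformly on
  \<open>{0..r}\<close> by the M-test. Near \<open>\<tau>\<close> the intervals
  \<open>{0..r}\<close> and \<open>{0..T}\<close> coincide, which transfers the derivative,
  one-sided at 0.\<close>

lemma power_series_has_vector_derivative:
  fixes e :: "nat \<Rightarrow> 'a::banach"
  assumes e: "summable (\<lambda>n. norm (e n) * T ^ n)" and \<tau>: "0 \<le> \<tau>" "\<tau> < T"
  shows "((\<lambda>t. \<Sum>n. t ^ Suc n *\<^sub>R e n) has_vector_derivative (\<Sum>n. (real (Suc n) * \<tau> ^ n) *\<^sub>R e n)) (at \<tau> within {0..T})"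
proof -
  define r where "r = (\<tau> + T) / 2"
  have r: "\<tau> < r" "r < T" "0 < r" using \<tau> by (auto simp: r_def)
  define g' where "g' s = (\<Sum>n. (real (Suc n) * s ^ n) *\<^sub>R e n)" for s
  have unif: "uniform_limit {0..r} (\<lambda>n s. \<Sum>i<n. (real (Suc i) * s ^ i) *\<^sub>R e i) g' sequentially"
    unfolding g'_def
  proof (rule Weierstrass_m_test)
    show "summable (\<lambda>n. real (Suc n) * norm (e n) * r ^ n)"
      using r by (intro summable_Suc_mult_power[OF e]) auto
    show "norm ((real (Suc n) * s ^ n) *\<^sub>R e n) \<le> real (Suc n) * norm (e n) * r ^ n" if "s \<in> {0..r}" for n s
      using that power_mono[of s r n] by (simp add: mult_ac mult_left_mono mult_right_mono del: of_nat_Suc)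
  qed
  have "\<exists>g. \<forall>s\<in>{0..r}. (\<lambda>n. s ^ Suc n *\<^sub>R e n) sums g s \<and> (g has_derivative (\<lambda>h. h *\<^sub>R g' s)) (at s within {0..r})"
  proof (rule has_derivative_series[where f' = "\<lambda>n s h. h *\<^sub>R ((real (Suc n) * s ^ n) *\<^sub>R e n)"])
    show "((\<lambda>s. s ^ Suc n *\<^sub>R e n) has_derivative (\<lambda>h. h *\<^sub>R ((real (Suc n) * s ^ n) *\<^sub>R e n))) (at s within {0..r})" for n s
      using has_derivative_scaleR_left[OF DERIV_pow[of "Suc n" s "{0..r}", unfolded has_field_derivative_def], of "e n"]
      by (simp add: mult_ac del: of_nat_Suc power_Suc)
    show "0 \<in> {0..r}" using r by simp
    show "(\<lambda>n. 0 ^ Suc n *\<^sub>R e n) sums 0" by simp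
    fix \<epsilon> :: real assume "\<epsilon> > 0"
    then have "\<forall>\<^sub>F n in sequentially. \<forall>s\<in>{0..r}. dist (\<Sum>i<n. (real (Suc i) * s ^ i) *\<^sub>R e i) (g' s) < \<epsilon>"
      using unif unfolding uniform_limit_iff by blast
    then show "\<forall>\<^sub>F n in sequentially. \<forall>s\<in>{0..r}. \<forall>h. norm ((\<Sum>i<n. h *\<^sub>R ((real (Suc i) * s ^ i) *\<^sub>R e i)) - h *\<^sub>R g' s) \<le> \<epsilon> * norm h"
    proof eventually_elim
      case (elim n)
      show ?case
      proof (intro ballI allI)
        fix s h :: real assume "s \<in> {0..r}"
        then have "norm ((\<Sum>i<n. (real (Suc i) * s ^ i) *\<^sub>R e i) - g' s) \<le> \<epsilon>"
          using elim by (auto simp: dist_norm less_imp_le)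
        then have "norm h * norm ((\<Sum>i<n. (real (Suc i) * s ^ i) *\<^sub>R e i) - g' s) \<le> norm h * \<epsilon>"
          by (intro mult_left_mono) auto
        also have "norm h * norm ((\<Sum>i<n. (real (Suc i) * s ^ i) *\<^sub>R e i) - g' s)
            = norm ((\<Sum>i<n. h *\<^sub>R ((real (Suc i) * s ^ i) *\<^sub>R e i)) - h *\<^sub>R g' s)"
          unfolding scaleR_sum_right[symmetric] scaleR_diff_right[symmetric] by simp
        finally show "norm ((\<Sum>i<n. h *\<^sub>R ((real (Suc i) * s ^ i) *\<^sub>R e i)) - h *\<^sub>R g' s) \<le> \<epsilon> * norm h"
          by (simp add: mult.commute)
      qed
    qed
  qed auto
  then obtain g where g: "\<And>s. s \<in> {0..r} \<Longrightarrow> (\<lambda>n. s ^ Suc n *\<^sub>R e n) sums g s"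
      "\<And>s. s \<in> {0..r} \<Longrightarrow> (g has_vector_derivative g' s) (at s within {0..r})"
    unfolding has_vector_derivative_def by blast
  have "((\<lambda>t. \<Sum>n. t ^ Suc n *\<^sub>R e n) has_vector_derivative g' \<tau>) (at \<tau> within {0..r})"
  proof (rule has_vector_derivative_transform[OF _ _ g(2)])
    show "(\<Sum>n. s ^ Suc n *\<^sub>R e n) = g s" if "s \<in> {0..r}" for s
      using g(1)[OF that] by (rule sums_unique[symmetric])
  qed (use \<tau> r in auto)
  moreover have "at \<tau> within {0..r} = at \<tau> within {0..T}"
    using r by (intro at_within_nhd[of \<tau> "{..<r}"]) auto
  ultimately show ?thesis by (simp add: g'_def)
qed

lemma LD_eq_power_series:
  fixes x y :: "real \<Rightarrow> 'a::euclidean_space"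
  assumes \<alpha>: "0 < \<alpha>" "\<alpha> < 1" and T: "0 < T"
    and d: "summable (\<lambda>n. norm (d n) * T ^ n)" and y: "\<And>s. s \<in> {0..T} \<Longrightarrow> y s = (\<Sum>n. s ^ n *\<^sub>R d n)"
    and x: "\<And>t. t \<in> {0..T} \<Longrightarrow> x t = x0 + LJ \<alpha> y t"
    and t: "t \<in> {0..T}"
  shows "LD T \<alpha> x t = y t"
proof -
  have Gpos: "Gamma (2 - \<alpha>) > 0" "Gamma (1 - \<alpha>) > 0"
    using \<alpha> by (auto intro!: Gamma_real_pos)
  define l where "l n = mlf_coeff \<alpha> n / mlf_coeff \<alpha> (Suc n)" for n
  have l_pos: "l n > 0" for n using mlf_coeff_pos[OF \<alpha>(2)] by (simp add: l_def)
  have l_le: "l n \<le> 1 / Gamma (2 - \<alpha>)" for n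
  proof -
    have "real (Suc n) powr (-\<alpha>) \<le> 1"
      using \<alpha> powr_mono[of "- \<alpha>" 0 "real (Suc n)"] by simp
    then have "real (Suc n) powr (-\<alpha>) / Gamma (2 - \<alpha>) \<le> 1 / Gamma (2 - \<alpha>)"
      using Gpos by (intro divide_right_mono) auto
    then show ?thesis using mlf_coeff_ratio_le[OF \<alpha>, of n] by (simp add: l_def)
  qed
  define e where "e n = l n *\<^sub>R d n" for n
  have e: "summable (\<lambda>n. norm (e n) * T ^ n)"
  proof (rule summable_comparison_test')
    show "summable (\<lambda>n. 1 / Gamma (2 - \<alpha>) * (norm (d n) * T ^ n))" using d by (rule summable_mult)
    show "norm (norm (e n) * T ^ n) \<le> 1 / Gamma (2 - \<alpha>) * (norm (d n) * T ^ n)" for n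
    proof -
      have "l n * (norm (d n) * T ^ n) \<le> 1 / Gamma (2 - \<alpha>) * (norm (d n) * T ^ n)"
        using T by (intro mult_right_mono l_le) auto
      then show ?thesis using T l_pos[of n] by (simp add: e_def abs_mult mult.assoc)
    qed
  qed
  define g where "g \<tau> = (\<Sum>n. (real (Suc n) * \<tau> ^ n) *\<^sub>R e n)" for \<tau>
  have deriv: "vector_derivative x (at \<tau> within {0..T}) = g \<tau>" if \<tau>: "0 \<le> \<tau>" "\<tau> < T" for \<tau>
  proof -
    have "((\<lambda>t. x0 + (\<Sum>n. t ^ Suc n *\<^sub>R e n)) has_vector_derivative g \<tau>) (at \<tau> within {0..T})"
      using power_series_has_vector_derivative[OF e \<tau>] unfolding g_def[symmetric]
      by (auto intro!: derivative_eq_intros)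
    then have "(x has_vector_derivative g \<tau>) (at \<tau> within {0..T})"
    proof (rule has_vector_derivative_transform[rotated 2])
      show "x s = x0 + (\<Sum>n. s ^ Suc n *\<^sub>R e n)" if "s \<in> {0..T}" for s
        using sums_unique[OF LJ_power_series[OF \<alpha> that d y]] x[OF that]
        by (simp add: e_def l_def mult.commute)
    qed (use \<tau> in auto)
    then show ?thesis
      using vector_derivative_within_cbox[OF T, of \<tau> x "g \<tau>"] \<tau> by simp
  qed
  show ?thesis
  proof (cases "t = 0")
    case True
    \<comment> \<open>Only the terms with \<open>n = 0\<close> survive at the origin, as
      \<open>0 ^ 0 = 1\<close>; they agree because \<open>l 0 = 1\<close>.\<close>
    have "g 0 = (\<Sum>n\<in>{0}. (real (Suc n) * 0 ^ n) *\<^sub>R e n)"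
      unfolding g_def by (rule suminf_finite) auto
    moreover have "y 0 = (\<Sum>n\<in>{0}. 0 ^ n *\<^sub>R d n)"
      unfolding y[OF t[unfolded True]] by (rule suminf_finite) auto
    moreover have "l 0 = 1"
      unfolding l_def mlf_coeff_ratio[OF \<alpha>(2)] using Gpos Gamma_numeral[of "num.Bit0 num.One", where ?'a = real] by simp
    ultimately show ?thesis
      using deriv[of 0] T True by (simp add: LD_def e_def)
  next
    case False
    then have t0: "t > 0" "t \<le> T" using t by auto
    define \<kappa> where "\<kappa> n \<tau> = (t - \<tau>) powr (- \<alpha>) * \<tau> ^ n" for n \<tau>
    define b where "b n = t powr (real n + 1 - \<alpha>) * Beta (real n + 1) (1 - \<alpha>)" for n
    have \<kappa>_int: "(\<kappa> n has_integral b n) {0..t}" for n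
    proof -
      have "((\<lambda>s. (s - 0) powr ((real n + 1) - 1) * (t - s) powr ((1 - \<alpha>) - 1)) has_integral
        (t - 0) powr ((real n + 1) + (1 - \<alpha>) - 1) * Beta (real n + 1) (1 - \<alpha>)) {0..t}"
        using \<alpha> t0 by (intro has_integral_Beta_kernel) auto
      then have "((\<lambda>s. s powr real n * (t - s) powr (- \<alpha>)) has_integral b n) {0..t}"
        by (simp add: b_def algebra_simps)
      \<comment> \<open>The two forms of the integrand differ at the origin for
        \<open>n = 0\<close>, where \<open>0 powr 0\<close> is 0 but \<open>0 ^ 0\<close> is
        1.\<close>
      then show ?thesis
        by (rule has_integral_spike[of "{0}", rotated 2]) (auto simp: \<kappa>_def powr_realpow)
    qed
    have \<kappa>: "set_integrable lborel {0..t} (\<kappa> n)" "(LINT s:{0..t}|lborel. \<kappa> n s) = b n" for n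
    proof -
      have "\<kappa> n \<in> borel_measurable borel" unfolding \<kappa>_def by measurable
      from set_integrable_lborel_nonneg[OF this _ _ \<kappa>_int[of n]]
      show "set_integrable lborel {0..t} (\<kappa> n)" "(LINT s:{0..t}|lborel. \<kappa> n s) = b n"
        by (simp_all add: \<kappa>_def)
    qed
    define f where "f n \<tau> = indicator {0..t} \<tau> *\<^sub>R (\<kappa> n \<tau> *\<^sub>R (real (Suc n) *\<^sub>R e n))" for n \<tau>
    have f_alt: "f n \<tau> = (indicator {0..t} \<tau> *\<^sub>R \<kappa> n \<tau>) *\<^sub>R (real (Suc n) *\<^sub>R e n)" for n \<tau>
      by (simp add: f_def)
    \<comment> \<open>The factor \<open>Suc n\<close> from differentiation, the Beta value and the
      quotient \<open>l n\<close> cancel up to a constant independent of \<open>n\<close>. This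
      evaluates the integrals of the terms and of their norms alike.\<close>
    have coeff: "b n * (real (Suc n) * l n) = Gamma (1 - \<alpha>) / Gamma (2 - \<alpha>) * t powr (1 - \<alpha>) * t ^ n" for n
    proof -
      have "Gamma (real n + 2) = (real n + 1) * Gamma (real n + 1)"
        using Gamma_plus1[of "real n + 1"] by (auto simp: add.commute nonpos_Ints_def)
      then have ratio: "l n = Gamma (real n + 2 - \<alpha>) / (Gamma (2 - \<alpha>) * (real (Suc n) * Gamma (real n + 1)))"
        unfolding l_def mlf_coeff_ratio[OF \<alpha>(2)] by (simp add: add.commute)
      have pos: "Gamma (real n + 1) > 0" "Gamma (real n + 2 - \<alpha>) > 0"
        using \<alpha> by (auto intro!: Gamma_real_pos)
      have "t powr (real n + 1 - \<alpha>) = t powr ((1 - \<alpha>) + real n)" by (simp add: algebra_simps)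
      also have "\<dots> = t powr (1 - \<alpha>) * t ^ n" using t0 by (subst powr_add) (simp add: powr_realpow)
      finally have b: "b n = t powr (1 - \<alpha>) * t ^ n * (Gamma (real n + 1) * Gamma (1 - \<alpha>) / Gamma (real n + 2 - \<alpha>))"
        by (simp add: b_def Beta_def algebra_simps)
      have cancel: "(u * (p * v / q)) * (N * (q / (w * (N * p)))) = v / w * u"
        if "p > 0" "q > 0" "w > 0" "N > 0" for u p v q N w :: real
        using that by (simp add: field_simps)
      have "b n * (real (Suc n) * l n) = Gamma (1 - \<alpha>) / Gamma (2 - \<alpha>) * (t powr (1 - \<alpha>) * t ^ n)"
        unfolding b ratio by (rule cancel) (use pos Gpos in auto)
      then show ?thesis by (simp only: mult.assoc)
    qed
    have f_int: "integrable lborel (f n)" "integral\<^sup>L lborel (f n) = (Gamma (1 - \<alpha>) / Gamma (2 - \<alpha>) * t powr (1 - \<alpha>)) *\<^sub>R (t ^ n *\<^sub>R d n)"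
      "(LINT \<tau>|lborel. norm (f n \<tau>)) = Gamma (1 - \<alpha>) / Gamma (2 - \<alpha>) * t powr (1 - \<alpha>) * (norm (d n) * t ^ n)" for n
    proof -
      show "integrable lborel (f n)"
        unfolding f_alt using \<kappa>(1)[of n] by (intro integrable_scaleR_left) (simp add: set_integrable_def)
      have "integral\<^sup>L lborel (f n) = b n *\<^sub>R (real (Suc n) *\<^sub>R e n)"
        unfolding f_alt using \<kappa>[of n] by (subst integral_scaleR_left) (simp_all add: set_integrable_def set_lebesgue_integral_def)
      also have "\<dots> = (b n * (real (Suc n) * l n)) *\<^sub>R d n" by (simp add: e_def mult.assoc)
      finally show "integral\<^sup>L lborel (f n) = (Gamma (1 - \<alpha>) / Gamma (2 - \<alpha>) * t powr (1 - \<alpha>)) *\<^sub>R (t ^ n *\<^sub>R d n)"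
        unfolding coeff by simp
      have "norm (f n \<tau>) = (indicator {0..t} \<tau> *\<^sub>R \<kappa> n \<tau>) * norm (real (Suc n) *\<^sub>R e n)" for \<tau>
        by (auto simp: f_alt indicator_def \<kappa>_def)
      then have "(LINT \<tau>|lborel. norm (f n \<tau>)) = b n * norm (real (Suc n) *\<^sub>R e n)"
        using \<kappa>[of n] by (simp add: set_integrable_def set_lebesgue_integral_def)
      also have "\<dots> = (b n * (real (Suc n) * l n)) * norm (d n)"
        using l_pos[of n] by (simp add: e_def mult.assoc)
      finally show "(LINT \<tau>|lborel. norm (f n \<tau>)) = Gamma (1 - \<alpha>) / Gamma (2 - \<alpha>) * t powr (1 - \<alpha>) * (norm (d n) * t ^ n)"
        unfolding coeff by simp
    qed
    have norm_summable: "summable (\<lambda>n. norm (f n \<tau>))" if "\<tau> \<noteq> t" for \<tau>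
    proof (cases "\<tau> \<in> {0..t}")
      case True
      have "summable (\<lambda>n. real (Suc n) * norm (e n) * \<tau> ^ n)"
        using True that t0 by (intro summable_Suc_mult_power[OF e]) auto
      then have "summable (\<lambda>n. (t - \<tau>) powr (- \<alpha>) * (real (Suc n) * norm (e n) * \<tau> ^ n))"
        by (rule summable_mult)
      then show ?thesis using True by (simp add: f_def \<kappa>_def mult_ac abs_mult)
    qed (simp add: f_def)
    have ns: "AE \<tau> in lborel. summable (\<lambda>n. norm (f n \<tau>))"
      using AE_lborel_singleton[of t] by eventually_elim (rule norm_summable)
    have ts: "summable (\<lambda>n. norm (d n) * t ^ n)"
    proof (rule summable_comparison_test'[OF d])
      show "norm (norm (d n) * t ^ n) \<le> norm (d n) * T ^ n" for n
        using t0 by (auto simp: abs_mult intro!: mult_left_mono power_mono)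
    qed
    then have int_s: "summable (\<lambda>n. LINT \<tau>|lborel. norm (f n \<tau>))"
      unfolding f_int(3) by (rule summable_mult)
    define F where "F \<tau> = (t - \<tau>) powr (- \<alpha>) *\<^sub>R g \<tau>" for \<tau>
    have F_eq: "indicator {0..t} \<tau> *\<^sub>R F \<tau> = (\<Sum>n. f n \<tau>)" if "\<tau> \<noteq> t" for \<tau>
    proof (cases "\<tau> \<in> {0..t}")
      case True
      have "summable (\<lambda>n. real (Suc n) * norm (e n) * \<tau> ^ n)"
        using True that t0 by (intro summable_Suc_mult_power[OF e]) auto
      then have "summable (\<lambda>n. (real (Suc n) * \<tau> ^ n) *\<^sub>R e n)"
        using True by (intro summable_norm_cancel[of "\<lambda>n. (real (Suc n) * \<tau> ^ n) *\<^sub>R e n"]) (simp add: mult_ac abs_mult)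
      from suminf_scaleR_right[OF this, of "(t - \<tau>) powr (- \<alpha>)"] True
      show ?thesis by (simp add: F_def g_def f_def \<kappa>_def mult_ac)
    qed (simp add: f_def)
    have S_int: "set_integrable lborel {0..t} (\<lambda>\<tau>. \<Sum>n. f n \<tau>)" "(LINT \<tau>:{0..t}|lborel. (\<Sum>n. f n \<tau>)) = (LINT \<tau>|lborel. (\<Sum>n. f n \<tau>))"
    proof -
      have eq: "indicator {0..t} \<tau> *\<^sub>R (\<Sum>n. f n \<tau>) = (\<Sum>n. f n \<tau>)" for \<tau>
        by (cases "\<tau> \<in> {0..t}") (auto simp: f_def)
      show "set_integrable lborel {0..t} (\<lambda>\<tau>. \<Sum>n. f n \<tau>)" "(LINT \<tau>:{0..t}|lborel. (\<Sum>n. f n \<tau>)) = (LINT \<tau>|lborel. (\<Sum>n. f n \<tau>))"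
        unfolding set_integrable_def set_lebesgue_integral_def eq
        using integrable_suminf[OF f_int(1) ns int_s] by auto
    qed
    have "integral {0..t} (\<lambda>\<tau>. (t - \<tau>) powr (- \<alpha>) *\<^sub>R vector_derivative x (at \<tau> within {0..T})) = integral {0..t} (\<lambda>\<tau>. \<Sum>n. f n \<tau>)"
    \<comment> \<open>The derivative of \<open>x\<close> has been computed only below
      \<open>T\<close>, so the endpoint is removed as a null set to include
      \<open>t = T\<close>.\<close>
    proof (rule integral_spike[of "{t}"])
      fix \<tau> assume "\<tau> \<in> {0..t} - {t}"
      then show "(\<Sum>n. f n \<tau>) = (t - \<tau>) powr (- \<alpha>) *\<^sub>R vector_derivative x (at \<tau> within {0..T})"
        using F_eq[of \<tau>] deriv[of \<tau>] t0 by (simp add: F_def)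
    qed auto
    also have "\<dots> = (LINT \<tau>|lborel. (\<Sum>n. f n \<tau>))"
      using set_borel_integral_eq_integral(2)[OF S_int(1)] S_int(2) by simp
    also have "\<dots> = (\<Sum>n. (Gamma (1 - \<alpha>) / Gamma (2 - \<alpha>) * t powr (1 - \<alpha>)) *\<^sub>R (t ^ n *\<^sub>R d n))"
      unfolding integral_suminf[OF f_int(1) ns int_s] f_int(2) ..
    also have "\<dots> = (Gamma (1 - \<alpha>) / Gamma (2 - \<alpha>) * t powr (1 - \<alpha>)) *\<^sub>R y t"
      unfolding y[OF t]
    proof (rule suminf_scaleR_right[symmetric])
      show "summable (\<lambda>n. t ^ n *\<^sub>R d n)"
        using ts t0 by (intro summable_norm_cancel[of "\<lambda>n. t ^ n *\<^sub>R d n"]) (simp add: mult.commute)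
    qed
    finally have "caputo T \<alpha> x t = (t powr (1 - \<alpha>) / Gamma (2 - \<alpha>)) *\<^sub>R y t"
      unfolding caputo_def using Gpos by simp
    then show ?thesis
      using t0 Gpos by (simp add: LD_def)
  qed
qed

theorem mainTheorem9:
  fixes \<alpha> T :: real and A :: "complex^'d^'d" and \<theta> :: "real \<Rightarrow> complex^'d"
    and x0 :: "complex^'d" and x :: "real \<Rightarrow> complex^'d"
  assumes "0 < \<alpha>" "\<alpha> < 1" "0 < T"
    and "continuous_on {0..T} \<theta>"
    and x_def: "x = (\<lambda>t. mlf_mat \<alpha> (t *\<^sub>R A) *v x0
                       + (\<Sum>j. mat_pow A j *v LJ_iter (j + 1) \<alpha> \<theta> t))"
  shows "(\<forall>t\<in>{0..T}. summable (mlf_term \<alpha> (t *\<^sub>R A))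
            \<and> summable (\<lambda>j. mat_pow A j *v LJ_iter (j + 1) \<alpha> \<theta> t))
      \<and> continuous_on {0..T} x
      \<and> (\<forall>t\<in>{0..T}.
            (\<lambda>s. ((t - s) powr (\<alpha> - 1) * s powr (1 - \<alpha>)) *\<^sub>R (A *v x s + \<theta> s)) integrable_on {0..t}
          \<and> x t = x0 + (1 / (Gamma \<alpha> * Gamma (2 - \<alpha>))) *\<^sub>R
              integral {0..t} (\<lambda>s. ((t - s) powr (\<alpha> - 1) * s powr (1 - \<alpha>)) *\<^sub>R (A *v x s + \<theta> s)))
      \<and> (abs_cont_on T x \<and> abs_cont_on T \<theta> \<longrightarrow>
            (AE t in lborel. t \<in> {0..T} \<longrightarrow> LD T \<alpha> x t = A *v x t + \<theta> t) \<and> x 0 = x0)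
      \<and> (power_series_on T x \<and> power_series_on T \<theta> \<longrightarrow>
            (\<forall>t\<in>{0..T}. LD T \<alpha> x t = A *v x t + \<theta> t))"
proof -
  note \<alpha> = assms(1,2) and T = assms(3) and \<theta> = assms(4)
  note sol = mlf_solution_integral_equation[OF \<alpha> \<theta> x_def]
  define y where "y s = A *v x s + \<theta> s" for s
  have y: "continuous_on {0..T} y"
    unfolding y_def
    by (intro continuous_intros bounded_linear.continuous_on[OF matrix_vector_mul_bounded_linear] sol(2) \<theta>)
  have x_eq: "x t = x0 + LJ \<alpha> y t" if "t \<in> {0..T}" for t
    using sol(3)[OF that] by (simp add: y_def[abs_def])
  have int: "(\<lambda>s. ((t - s) powr (\<alpha> - 1) * s powr (1 - \<alpha>)) *\<^sub>R y s) integrable_on {0..t}" if "t \<in> {0..T}" for t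
    using that by (intro LJ_kernel_integrable \<alpha> continuous_on_subset[OF y]) auto
  have x_int: "x t = x0 + (1 / (Gamma \<alpha> * Gamma (2 - \<alpha>))) *\<^sub>R
      integral {0..t} (\<lambda>s. ((t - s) powr (\<alpha> - 1) * s powr (1 - \<alpha>)) *\<^sub>R y s)" if "t \<in> {0..T}" for t
    using x_eq[OF that] by (simp add: LJ_def)
  have x_0: "x 0 = x0"
    using x_eq[of 0] T by (simp add: LJ_def)
  have ae: "AE t in lborel. t \<in> {0..T} \<longrightarrow> LD T \<alpha> x t = y t" if "abs_cont_on T x"
    using \<alpha> T y x_eq that by (rule LD_eq_AE)
  have ps: "LD T \<alpha> x t = y t" if ps: "power_series_on T x" "power_series_on T \<theta>" and t: "t \<in> {0..T}" for t
  proof -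
    obtain a where a: "summable (\<lambda>n. norm (a n) * T ^ n)" "\<And>t. t \<in> {0..T} \<Longrightarrow> x t = (\<Sum>n. t ^ n *\<^sub>R a n)"
      using ps(1) unfolding power_series_on_def by blast
    obtain b where b: "summable (\<lambda>n. norm (b n) * T ^ n)" "\<And>t. t \<in> {0..T} \<Longrightarrow> \<theta> t = (\<Sum>n. t ^ n *\<^sub>R b n)"
      using ps(2) unfolding power_series_on_def by blast
    obtain K where K: "\<And>v. norm (A *v v) \<le> norm v * K"
      using bounded_linear.bounded[OF matrix_vector_mul_bounded_linear[of A]] by blast
    \<comment> \<open>The coefficients of the right-hand side are \<open>A *v a n + b n\<close>;
      boundedness of \<open>A\<close> gives both their absolute convergence at \<open>T\<close> and
      the termwise application of \<open>A\<close>.\<close>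
    show ?thesis
    proof (rule LD_eq_power_series[OF \<alpha> T _ _ x_eq t])
      show "summable (\<lambda>n. norm (A *v a n + b n) * T ^ n)"
      proof (rule summable_comparison_test')
        show "summable (\<lambda>n. norm (a n) * T ^ n * K + norm (b n) * T ^ n)"
          by (intro summable_add summable_mult2 a(1) b(1))
        fix n
        have "norm (A *v a n + b n) * T ^ n \<le> (norm (a n) * K + norm (b n)) * T ^ n"
          using K[of "a n"] norm_triangle_ineq[of "A *v a n" "b n"] T by (intro mult_right_mono) auto
        then show "norm (norm (A *v a n + b n) * T ^ n) \<le> norm (a n) * T ^ n * K + norm (b n) * T ^ n"
          using T by (simp add: algebra_simps)
      qed
      fix s assume s: "s \<in> {0..T}"
      have sums: "summable (\<lambda>n. s ^ n *\<^sub>R c n)" if "summable (\<lambda>n. norm (c n) * T ^ n)" for c :: "nat \<Rightarrow> complex^'d"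
      proof (rule summable_comparison_test'[OF that])
        show "norm (s ^ n *\<^sub>R c n) \<le> norm (c n) * T ^ n" for n
          using s by (auto simp: mult.commute[of "norm (c n)"] intro!: mult_right_mono power_mono)
      qed
      have "A *v x s = (\<Sum>n. s ^ n *\<^sub>R (A *v a n))"
        unfolding a(2)[OF s] scaleR_matrix_vector_mult(2)[symmetric]
        by (rule bounded_linear.suminf[OF matrix_vector_mul_bounded_linear sums[OF a(1)]])
      moreover have "summable (\<lambda>n. s ^ n *\<^sub>R (A *v a n))"
        unfolding scaleR_matrix_vector_mult(2)[symmetric]
        by (rule bounded_linear.summable[OF matrix_vector_mul_bounded_linear sums[OF a(1)]])
      ultimately show "y s = (\<Sum>n. s ^ n *\<^sub>R (A *v a n + b n))"
        using suminf_add[OF _ sums[OF b(1)]] b(2)[OF s] by (simp add: y_def scaleR_add_right)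
    qed
  qed
  show ?thesis
    unfolding y_def[symmetric]
  proof (intro conjI ballI impI)
    show "summable (mlf_term \<alpha> (t *\<^sub>R A))" if "t \<in> {0..T}" for t
      using that by (intro summable_mlf_term \<alpha>) auto
  qed (use sol(1,2) int x_int x_0 ae ps in blast)+
qed

end
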